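(* Let $f_n(q)=\sum_{i=1}^m c_i\,f_{\tau_i}(q^n,q)$ be a finite $K$-linear combination ($c_i\in K$) of evaluations of formal WKB series $f_{\tau_i}$. Then for all sufficiently large $n$, the degree $\delta(f_n(q))$ is given by a quadratic quasi-polynomial in $n$, and the leading term $\mathrm{lt}(f_n(q))$ satisfies a linear recursion relation with constant coefficients.
   Context: Let $K=\bigcup_{r\ge1}\overline{\mathbb Q}((q^{1/r}))$ be the field of Puiseux series in $q$ with algebraic coefficients. For $0\neq f\in K$, $\delta(f)$ is the smallest exponent of $q$ in $f$ and $\mathrm{lt}(f)$ is the coefficient of $q^{\delta(f)}$. A formal WKB series is an expression $f_\tau(u,q)=q^{\gamma n^2}\lambda(q)^nA(n,u,q)$, where $\tau=(\gamma,\lambda,A)$, $\gamma\in\mathbb Q$, $\lambda(q)\in\overline{\mathbb Q}((q^{1/r}))$, and $A(n,u,q)=\sum_{i=0}^{M'}\sum_{k\ge0}\phi_{i,k}(q)u^{k/r}n^i$ is a polynomial in $n$ with coefficients in $\overline{\mathbb Q}((q^{1/r}))[[u^{1/r}]]$ for some $r\in\mathbb N$, with $\phi_{0,0}=1$ and such that there is $c\in\mathbb Q$ with $\delta(\phi_{i,k})\ge ck$ for all $i,k$. Its evaluation $f_\tau(q^n,q)$ (substituting $u=q^n$) is a well-defined element of $K$ for $n>-rc$. A quasi-polynomial is a function on $\mathbb N$ of the form $\sum_{j=0}^dc_j(n)n^j$ with each $c_j$ periodic with integral period; it is quadratic if $c_j=0$ for $j>2$. *)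

theory Defs
  imports
    "HOL-Computational_Algebra.Computational_Algebra"
    "HOL-Algebra.Algebraic_Closure_Type"
begin

section \<open>Puiseux series\<close>

text \<open>
  A Puiseux series is represented by its coefficient function on the rational exponents.
  The coefficient function of \<open>F(q\<^bsup>1/r\<^esup>)\<close>, where \<open>F\<close> is a formal Laurent series, is:
\<close>

definition ramify :: "nat \<Rightarrow> 'a::zero fls \<Rightarrow> rat \<Rightarrow> 'a" where
  "ramify r F x = (if of_nat r * x \<in> \<int> then fls_nth F \<lfloor>of_nat r * x\<rfloor> else 0)"

typedef (overloaded) 'a puiseux = "\<Union>r\<in>{1..}. range (ramify r :: 'a::zero fls \<Rightarrow> rat \<Rightarrow> 'a)"
  morphisms puiseux_nth Abs_puiseux
  by auto

lemma puiseux_eqI: "(\<And>x. puiseux_nth f x = puiseux_nth g x) \<Longrightarrow> f = g"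
  by (metis ext puiseux_nth_inject)

lemma ramify_range_iff:
  assumes "r \<ge> 1"
  shows "f \<in> range (ramify r) \<longleftrightarrow>
    (\<exists>N::int. \<forall>x. f x \<noteq> 0 \<longrightarrow> of_nat r * x \<in> \<int> \<and> of_int N \<le> of_nat r * x)"
proof
  assume "f \<in> range (ramify r)"
  then obtain F where F: "f = ramify r F" by auto
  show "\<exists>N::int. \<forall>x. f x \<noteq> 0 \<longrightarrow> of_nat r * x \<in> \<int> \<and> of_int N \<le> of_nat r * x"
  proof (intro exI[of _ "fls_subdegree F"] allI impI)
    fix x assume nz: "f x \<noteq> 0"
    hence i: "of_nat r * x \<in> \<int>" by (auto simp: F ramify_def split: if_splits)
    moreover have "fls_subdegree F \<le> \<lfloor>of_nat r * x\<rfloor>"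
      using nz i by (intro fls_subdegree_leI) (auto simp: F ramify_def)
    ultimately show "of_nat r * x \<in> \<int> \<and> of_int (fls_subdegree F) \<le> of_nat r * x"
      by (auto elim!: Ints_cases)
  qed
next
  assume "\<exists>N::int. \<forall>x. f x \<noteq> 0 \<longrightarrow> of_nat r * x \<in> \<int> \<and> of_int N \<le> of_nat r * x"
  then obtain N :: int
    where N: "\<And>x. f x \<noteq> 0 \<Longrightarrow> of_nat r * x \<in> \<int> \<and> of_int N \<le> of_nat r * x" by auto
  define F where "F = Abs_fls (\<lambda>n. f (of_int n / of_nat r))"
  have F_nth: "fls_nth F n = f (of_int n / of_nat r)" for n
    unfolding F_def
  proof (rule nth_Abs_fls_lower_bound[of N], intro allI impI)
    fix k :: int assume "k < N"
    thus "f (of_int k / of_nat r) = 0"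
      using N[of "of_int k / of_nat r"] assms by (cases "f (of_int k / of_nat r) = 0") auto
  qed
  have "f = ramify r F"
  proof
    fix x show "f x = ramify r F x"
      using N[of x] assms by (cases "f x = 0") (auto simp: ramify_def F_nth elim!: Ints_cases)
  qed
  thus "f \<in> range (ramify r)" by blast
qed

text \<open>\<open>F(q\<^bsup>1/r\<^esup>)\<close> as a Puiseux series, and the set of Laurent series in \<open>q\<^bsup>1/r\<^esup>\<close>.\<close>

definition puiseux_of_fls :: "nat \<Rightarrow> 'a::zero fls \<Rightarrow> 'a puiseux" where
  "puiseux_of_fls r F = Abs_puiseux (ramify r F)"

definition laurent_root :: "nat \<Rightarrow> 'a::zero puiseux set" where
  "laurent_root r = range (puiseux_of_fls r)"

lemma puiseux_nth_of_fls: "r \<ge> 1 \<Longrightarrow> puiseux_nth (puiseux_of_fls r F) = ramify r F"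
  unfolding puiseux_of_fls_def by (rule Abs_puiseux_inverse) auto

lemma laurent_root_iff:
  assumes "r \<ge> 1"
  shows "f \<in> laurent_root r \<longleftrightarrow>
    (\<exists>N::int. \<forall>x. puiseux_nth f x \<noteq> 0 \<longrightarrow> of_nat r * x \<in> \<int> \<and> of_int N \<le> of_nat r * x)"
proof -
  have "f \<in> laurent_root r \<longleftrightarrow> puiseux_nth f \<in> range (ramify r)"
    unfolding laurent_root_def image_iff
    by (metis assms puiseux_nth_inject puiseux_nth_of_fls UNIV_I)
  thus ?thesis by (simp only: ramify_range_iff[OF assms])
qed

lemma laurent_root_mult:
  assumes "f \<in> laurent_root r" "r \<ge> 1" "s \<ge> 1"
  shows "f \<in> laurent_root (r * s)" "f \<in> laurent_root (s * r)"
proof -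
  obtain N :: int where N: "\<And>x. puiseux_nth f x \<noteq> 0 \<Longrightarrow> of_nat r * x \<in> \<int> \<and> of_int N \<le> of_nat r * x"
    using assms(1) unfolding laurent_root_iff[OF assms(2)] by blast
  have "of_nat (s * r) * x \<in> \<int> \<and> of_int (int s * N) \<le> of_nat (s * r) * x"
    if "puiseux_nth f x \<noteq> 0" for x
  proof -
    have "of_nat s * (of_nat r * x) \<in> \<int>" by (rule Ints_mult[OF Ints_of_nat conjunct1[OF N[OF that]]])
    moreover have "of_nat s * of_int N \<le> of_nat s * (of_nat r * x)"
      using conjunct2[OF N[OF that]] by (rule mult_left_mono) simp
    ultimately show ?thesis by (simp only: of_nat_mult of_int_mult of_int_of_nat_eq mult.assoc)
  qed
  moreover have sr: "s * r \<ge> 1" using assms by (simp add: Suc_le_eq)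
  ultimately show "f \<in> laurent_root (s * r)" unfolding laurent_root_iff[OF sr] by blast
  thus "f \<in> laurent_root (r * s)" by (simp add: mult.commute)
qed

lemma puiseux_in_laurent_root: "\<exists>r\<ge>1. f \<in> laurent_root r"
proof -
  obtain r F where "r \<ge> 1" "puiseux_nth f = ramify r F"
    using puiseux_nth[of f] by auto
  hence "r \<ge> 1" "f = puiseux_of_fls r F"
    by (auto simp: puiseux_of_fls_def) (metis puiseux_nth_inverse)
  thus ?thesis by (auto simp: laurent_root_def)
qed

lemma common_ramification3:
  obtains r F G H where "r \<ge> 1"
    "f = puiseux_of_fls r F" "g = puiseux_of_fls r G" "h = puiseux_of_fls r H"
proof -
  obtain a b c where abc: "a \<ge> 1" "b \<ge> 1" "c \<ge> 1"
    "f \<in> laurent_root a" "g \<in> laurent_root b" "h \<in> laurent_root c"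
    using puiseux_in_laurent_root by metis
  have ge: "a * b \<ge> 1" "b * c \<ge> 1" using abc by (simp_all add: Suc_le_eq)
  have "f \<in> laurent_root (a * b * c)" "g \<in> laurent_root (a * b * c)" "h \<in> laurent_root (a * b * c)"
    using laurent_root_mult(1)[OF laurent_root_mult(1), of f a b c]
      laurent_root_mult(1)[OF laurent_root_mult(2), of g b a c]
      laurent_root_mult(2)[of h c "a * b"] abc ge by auto
  moreover have "a * b * c \<ge> 1" using abc by (simp add: Suc_le_eq)
  ultimately show ?thesis using that unfolding laurent_root_def by blast
qed

instantiation puiseux :: (field) field
begin

definition zero_puiseux :: "'a puiseux" where "0 = Abs_puiseux (\<lambda>_. 0)"

definition one_puiseux :: "'a puiseux" where "1 = Abs_puiseux (\<lambda>x. if x = 0 then 1 else 0)"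

definition plus_puiseux :: "'a puiseux \<Rightarrow> 'a puiseux \<Rightarrow> 'a puiseux" where
  "f + g = Abs_puiseux (\<lambda>x. puiseux_nth f x + puiseux_nth g x)"

definition minus_puiseux :: "'a puiseux \<Rightarrow> 'a puiseux \<Rightarrow> 'a puiseux" where
  "f - g = Abs_puiseux (\<lambda>x. puiseux_nth f x - puiseux_nth g x)"

definition uminus_puiseux :: "'a puiseux \<Rightarrow> 'a puiseux" where
  "- f = Abs_puiseux (\<lambda>x. - puiseux_nth f x)"

definition times_puiseux :: "'a puiseux \<Rightarrow> 'a puiseux \<Rightarrow> 'a puiseux" where
  "f * g = Abs_puiseux (\<lambda>x. \<Sum>y | puiseux_nth f y \<noteq> 0 \<and> puiseux_nth g (x - y) \<noteq> 0.
     puiseux_nth f y * puiseux_nth g (x - y))"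

definition inverse_puiseux :: "'a puiseux \<Rightarrow> 'a puiseux" where
  "inverse (f :: 'a puiseux) = (if f = 0 then 0 else SOME g. f * g = 1)"

definition divide_puiseux :: "'a puiseux \<Rightarrow> 'a puiseux \<Rightarrow> 'a puiseux" where
  "f div g = f * inverse (g :: 'a puiseux)"

lemma of_fls_0: "puiseux_of_fls r (0 :: 'a fls) = 0"
  unfolding puiseux_of_fls_def zero_puiseux_def
  by (rule arg_cong[of _ _ Abs_puiseux]) (auto simp: fun_eq_iff ramify_def)

lemma of_fls_1: "r \<ge> 1 \<Longrightarrow> puiseux_of_fls r (1 :: 'a fls) = 1"
  unfolding puiseux_of_fls_def one_puiseux_def
  by (rule arg_cong[of _ _ Abs_puiseux])
     (auto simp: fun_eq_iff ramify_def elim!: Ints_cases)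

lemma of_fls_add:
  "r \<ge> 1 \<Longrightarrow> puiseux_of_fls r (F + G :: 'a fls) = puiseux_of_fls r F + puiseux_of_fls r G"
  unfolding plus_puiseux_def puiseux_nth_of_fls
  unfolding puiseux_of_fls_def
  by (rule arg_cong[of _ _ Abs_puiseux]) (auto simp: fun_eq_iff ramify_def)

lemma of_fls_diff:
  "r \<ge> 1 \<Longrightarrow> puiseux_of_fls r (F - G :: 'a fls) = puiseux_of_fls r F - puiseux_of_fls r G"
  unfolding minus_puiseux_def puiseux_nth_of_fls
  unfolding puiseux_of_fls_def
  by (rule arg_cong[of _ _ Abs_puiseux]) (auto simp: fun_eq_iff ramify_def)

lemma of_fls_uminus: "r \<ge> 1 \<Longrightarrow> puiseux_of_fls r (- F :: 'a fls) = - puiseux_of_fls r F"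
  unfolding uminus_puiseux_def puiseux_nth_of_fls
  unfolding puiseux_of_fls_def
  by (rule arg_cong[of _ _ Abs_puiseux]) (auto simp: fun_eq_iff ramify_def)

lemma fls_times_nth_support:
  "fls_nth (F * G :: 'a fls) n =
     (\<Sum>i | fls_nth F i \<noteq> 0 \<and> fls_nth G (n - i) \<noteq> 0. fls_nth F i * fls_nth G (n - i))"
proof -
  have "{i. fls_nth F i \<noteq> 0 \<and> fls_nth G (n - i) \<noteq> 0} \<subseteq> {fls_subdegree F..n - fls_subdegree G}"
    using fls_subdegree_leI[of F] fls_subdegree_leI[of G] by fastforce
  thus ?thesis unfolding fls_times_nth(2)
    by (intro sum.mono_neutral_right) auto
qed

lemma ramify_times:
  assumes r: "r \<ge> 1"
  shows "ramify r (F * G :: 'a fls) =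
    (\<lambda>x. \<Sum>y | ramify r F y \<noteq> 0 \<and> ramify r G (x - y) \<noteq> 0. ramify r F y * ramify r G (x - y))"
proof
  fix x
  let ?S = "{y. ramify r F y \<noteq> 0 \<and> ramify r G (x - y) \<noteq> 0}"
  show "ramify r (F * G) x = (\<Sum>y\<in>?S. ramify r F y * ramify r G (x - y))"
  proof (cases "of_nat r * x \<in> \<int>")
    case False
    have "of_nat r * x \<in> \<int>" if "y \<in> ?S" for y
    proof -
      have "of_nat r * y \<in> \<int>" "of_nat r * (x - y) \<in> \<int>"
        using that by (auto simp: ramify_def split: if_splits)
      hence "of_nat r * y + of_nat r * (x - y) \<in> \<int>" by (rule Ints_add)
      thus ?thesis by (simp add: algebra_simps)
    qed
    hence "?S = {}" using False by blast
    thus ?thesis using False by (simp only: ramify_def) simp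
  next
    case True
    then obtain n where n: "of_nat r * x = of_int n" by (auto elim: Ints_cases)
    let ?h = "\<lambda>i::int. of_int i / of_nat r :: rat"
    have Fh: "ramify r F (?h i) = fls_nth F i" for i using r by (simp add: ramify_def)
    have Gh: "ramify r G (x - ?h i) = fls_nth G (n - i)" for i
    proof -
      have "of_nat r * (x - ?h i) = of_int (n - i)" using r n by (simp add: algebra_simps)
      thus ?thesis unfolding ramify_def by (simp only: Ints_of_int floor_of_int if_True)
    qed
    have S: "?S = ?h ` {i. fls_nth F i \<noteq> 0 \<and> fls_nth G (n - i) \<noteq> 0}"
    proof (intro equalityI subsetI)
      fix y assume y: "y \<in> ?S"
      hence "of_nat r * y \<in> \<int>" by (auto simp: ramify_def split: if_splits)
      then obtain i where "of_nat r * y = of_int i" by (auto elim: Ints_cases)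
      hence "y = ?h i" using r by (simp add: field_simps)
      thus "y \<in> ?h ` {i. fls_nth F i \<noteq> 0 \<and> fls_nth G (n - i) \<noteq> 0}"
        using y Fh Gh by auto
    qed (auto simp: Fh Gh)
    have inj: "inj_on ?h A" for A using r by (auto simp: inj_on_def)
    have "(\<Sum>y\<in>?S. ramify r F y * ramify r G (x - y)) = fls_nth (F * G) n"
      unfolding S sum.reindex[OF inj] o_def Fh Gh fls_times_nth_support ..
    moreover have "ramify r (F * G) x = fls_nth (F * G) n"
      by (simp add: ramify_def n)
    ultimately show ?thesis by simp
  qed
qed

lemma of_fls_times:
  "r \<ge> 1 \<Longrightarrow> puiseux_of_fls r (F * G :: 'a fls) = puiseux_of_fls r F * puiseux_of_fls r G"
  unfolding times_puiseux_def puiseux_nth_of_fls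
  unfolding puiseux_of_fls_def
  by (rule arg_cong[of _ _ Abs_puiseux]) (simp only: ramify_times)

lemma times_puiseux_commute: "f * g = g * (f :: 'a puiseux)"
proof -
  obtain r F G H where r: "r \<ge> 1" and eq:
    "f = puiseux_of_fls r F" "g = puiseux_of_fls r G" "f = puiseux_of_fls r H"
    by (rule common_ramification3)
  show ?thesis unfolding eq(1,2) of_fls_times[OF r, symmetric] by (simp only: mult.commute)
qed

lemma of_fls_eq_iff:
  assumes "r \<ge> 1"
  shows "puiseux_of_fls r F = puiseux_of_fls r (G :: 'a fls) \<longleftrightarrow> F = G"
proof
  assume "puiseux_of_fls r F = puiseux_of_fls r G"
  hence "ramify r F (of_int n / of_nat r) = ramify r G (of_int n / of_nat r)" for n
    using puiseux_nth_of_fls[OF assms] by metis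
  thus "F = G" using assms by (intro fls_eqI) (simp add: ramify_def)
qed auto

instance
proof
  fix f g h :: "'a puiseux"
  obtain r F G H where r: "r \<ge> 1" and eq:
    "f = puiseux_of_fls r F" "g = puiseux_of_fls r G" "h = puiseux_of_fls r H"
    by (rule common_ramification3)
  note hom = of_fls_0[of r, symmetric] of_fls_1[OF r, symmetric] of_fls_add[OF r, symmetric]
    of_fls_diff[OF r, symmetric] of_fls_uminus[OF r, symmetric] of_fls_times[OF r, symmetric]
  show "f * g * h = f * (g * h)" "f * g = g * f" "1 * f = f" "f + g + h = f + (g + h)"
    "f + g = g + f" "0 + f = f" "- f + f = 0" "f - g = f + - g" "(f + g) * h = f * h + g * h"
    unfolding eq hom by (simp_all add: algebra_simps)
  show "(0 :: 'a puiseux) \<noteq> 1" unfolding hom of_fls_eq_iff[OF r] by simp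
  show "f div g = f * inverse g" by (rule divide_puiseux_def)
  show "inverse (0 :: 'a puiseux) = 0" by (simp add: inverse_puiseux_def)
  assume nz: "f \<noteq> 0"
  hence "F \<noteq> 0" unfolding eq hom of_fls_eq_iff[OF r] .
  hence "f * puiseux_of_fls r (inverse F) = 1"
    unfolding eq hom of_fls_eq_iff[OF r] by simp
  hence "f * inverse f = 1"
    using nz unfolding inverse_puiseux_def by (simp add: someI[of "\<lambda>g. f * g = 1"])
  thus "inverse f * f = 1" by (simp only: times_puiseux_commute)
qed

end

lemma puiseux_nth_0 [simp]: "puiseux_nth (0 :: 'a::field puiseux) x = 0"
  by (metis of_fls_0 puiseux_nth_of_fls order.refl ramify_def fls_zero_nth)

lemma puiseux_nth_1: "puiseux_nth (1 :: 'a::field puiseux) x = (if x = 0 then 1 else 0)"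
  using puiseux_nth_of_fls[of 1 "1 :: 'a fls"] of_fls_1[of 1, where 'a = 'a]
  by (auto simp: ramify_def elim!: Ints_cases)

lemma puiseux_nth_add [simp]:
  "puiseux_nth (f + g :: 'a::field puiseux) x = puiseux_nth f x + puiseux_nth g x"
proof -
  obtain r F G H where r: "r \<ge> 1" and eq: "f = puiseux_of_fls r F" "g = puiseux_of_fls r G"
    "f = puiseux_of_fls r H" by (rule common_ramification3)
  show ?thesis
    unfolding eq(1,2) of_fls_add[OF r, symmetric] puiseux_nth_of_fls[OF r] by (simp add: ramify_def)
qed

lemma puiseux_nth_times:
  "puiseux_nth (f * g :: 'a::field puiseux) x =
     (\<Sum>y | puiseux_nth f y \<noteq> 0 \<and> puiseux_nth g (x - y) \<noteq> 0. puiseux_nth f y * puiseux_nth g (x - y))"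
proof -
  obtain r F G H where r: "r \<ge> 1" and eq: "f = puiseux_of_fls r F" "g = puiseux_of_fls r G"
    "f = puiseux_of_fls r H" by (rule common_ramification3)
  have *: "(\<lambda>x. \<Sum>y | puiseux_nth f y \<noteq> 0 \<and> puiseux_nth g (x - y) \<noteq> 0.
      puiseux_nth f y * puiseux_nth g (x - y)) = ramify r (F * G)"
    using ramify_times[OF r, of F G] unfolding eq(1,2) puiseux_nth_of_fls[OF r] by (rule sym)
  have "ramify r (F * G) \<in> (\<Union>r\<in>{1..}. range (ramify r))" using r by blast
  hence "puiseux_nth (f * g) = ramify r (F * G)"
    unfolding times_puiseux_def * by (rule Abs_puiseux_inverse)
  thus ?thesis using fun_cong[OF *, of x] by (simp only:)
qed

text \<open>The power \<open>q\<^bsup>a\<^esup>\<close>, the degree and the leading coefficient; the degree of 0 is unspecified,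
  while its leading coefficient is 0.\<close>

definition q_powr :: "rat \<Rightarrow> 'a::field puiseux" where
  "q_powr a = Abs_puiseux (\<lambda>x. if x = a then 1 else 0)"

definition puiseux_deg :: "'a::field puiseux \<Rightarrow> rat" where
  "puiseux_deg f = (LEAST x. puiseux_nth f x \<noteq> 0)"

definition puiseux_lt :: "'a::field puiseux \<Rightarrow> 'a" where
  "puiseux_lt f = puiseux_nth f (puiseux_deg f)"

lemma puiseux_nth_q_powr: "puiseux_nth (q_powr a :: 'a::field puiseux) x = (if x = a then 1 else 0)"
proof -
  obtain i j where ij: "quotient_of a = (i, j)" by force
  hence j: "j > 0" and a: "a = of_int i / of_int j"
    by (auto dest: quotient_of_denom_pos quotient_of_div)
  have "(\<lambda>x. if x = a then 1 else 0 :: 'a) \<in> range (ramify (nat j))"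
    using j by (subst ramify_range_iff) (auto simp: a intro!: exI[of _ i])
  moreover have "nat j \<in> {1..}" using j by simp
  ultimately have "(\<lambda>x. if x = a then 1 else 0 :: 'a) \<in> (\<Union>r\<in>{1..}. range (ramify r))" by blast
  thus ?thesis unfolding q_powr_def by (simp only: Abs_puiseux_inverse)
qed

lemma puiseux_nth_times_q_powr: "puiseux_nth (f * q_powr a) x = puiseux_nth f (x - a)"
proof -
  have "{y. puiseux_nth f y \<noteq> 0 \<and> puiseux_nth (q_powr a :: 'a puiseux) (x - y) \<noteq> 0} =
      (if puiseux_nth f (x - a) = 0 then {} else {x - a})"
    by (auto simp: puiseux_nth_q_powr)
  thus ?thesis unfolding puiseux_nth_times by (simp add: puiseux_nth_q_powr)
qed

lemma puiseux_deg:
  assumes "f \<noteq> 0"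
  shows puiseux_lt_nonzero: "puiseux_lt f \<noteq> 0"
    and puiseux_deg_le: "puiseux_nth f x \<noteq> 0 \<Longrightarrow> puiseux_deg f \<le> x"
proof -
  obtain r where r: "r \<ge> 1" "f \<in> laurent_root r" using puiseux_in_laurent_root by blast
  then obtain F where F: "f = puiseux_of_fls r F" by (auto simp: laurent_root_def)
  hence "F \<noteq> 0" using assms by (auto simp: of_fls_0)
  define d where "d = (of_int (fls_subdegree F) / of_nat r :: rat)"
  have d: "puiseux_nth f d \<noteq> 0"
    using \<open>F \<noteq> 0\<close> r by (simp add: F puiseux_nth_of_fls ramify_def d_def)
  have le: "d \<le> y" if "puiseux_nth f y \<noteq> 0" for y
  proof -
    from that obtain m where m: "of_nat r * y = of_int m" "fls_nth F m \<noteq> 0"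
      using r by (auto simp: F puiseux_nth_of_fls ramify_def elim!: Ints_cases split: if_splits)
    have "of_int (fls_subdegree F) \<le> (of_int m :: rat)"
      using m by (simp add: fls_subdegree_leI)
    thus ?thesis using r unfolding d_def m(1)[symmetric] by (simp add: field_simps)
  qed
  have "puiseux_deg f = d" unfolding puiseux_deg_def
    by (rule Least_equality) (use d le in auto)
  thus "puiseux_lt f \<noteq> 0" "puiseux_nth f x \<noteq> 0 \<Longrightarrow> puiseux_deg f \<le> x"
    using d le by (auto simp: puiseux_lt_def)
qed

text \<open>Infinite sums that converge in the \<open>q\<close>-adic sense; meaningful only if every exponent occurs in
  finitely many of the summands and the coefficientwise sum is again a Puiseux series.\<close>

definition puiseux_suminf :: "(nat \<Rightarrow> 'a::field puiseux) \<Rightarrow> 'a puiseux" where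
  "puiseux_suminf g = Abs_puiseux (\<lambda>x. \<Sum>k | puiseux_nth (g k) x \<noteq> 0. puiseux_nth (g k) x)"

lemma puiseux_nth_suminf:
  fixes g :: "nat \<Rightarrow> 'a::field puiseux"
  assumes r: "r \<ge> 1" and d: "d > 0"
    and g: "\<And>k x. puiseux_nth (g k) x \<noteq> 0 \<Longrightarrow> of_nat r * x \<in> \<int> \<and> of_nat k * d \<le> x"
  shows "finite {k. puiseux_nth (g k) x \<noteq> 0}"
    and "puiseux_nth (puiseux_suminf g) x = (\<Sum>k | puiseux_nth (g k) x \<noteq> 0. puiseux_nth (g k) x)"
proof -
  have "k \<le> nat \<lfloor>x / d\<rfloor>" if "puiseux_nth (g k) x \<noteq> 0" for k
  proof -
    have "of_int (int k) \<le> x / d" using g[OF that] d by (simp add: field_simps)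
    thus ?thesis unfolding le_floor_iff[symmetric] by linarith
  qed
  thus "finite {k. puiseux_nth (g k) x \<noteq> 0}"
    by (intro rev_finite_subset[OF finite_atMost[of "nat \<lfloor>x / d\<rfloor>"]] subsetI) simp
  let ?s = "\<lambda>x. \<Sum>k | puiseux_nth (g k) x \<noteq> 0. puiseux_nth (g k) x"
  have "of_nat r * y \<in> \<int> \<and> of_int 0 \<le> of_nat r * y" if "?s y \<noteq> 0" for y
  proof -
    from that obtain k where "puiseux_nth (g k) y \<noteq> 0" by (rule sum.not_neutral_contains_not_neutral)
    from g[OF this] have "of_nat r * y \<in> \<int>" "of_nat k * d \<le> y" by auto
    moreover have "0 \<le> of_nat k * d" using d by simp
    ultimately show ?thesis by simp
  qed
  hence "?s \<in> range (ramify r)" unfolding ramify_range_iff[OF r] by (intro exI[of _ 0]) blast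
  hence "?s \<in> (\<Union>r\<in>{1..}. range (ramify r))" using r by blast
  thus "puiseux_nth (puiseux_suminf g) x = ?s x"
    unfolding puiseux_suminf_def by (simp only: Abs_puiseux_inverse)
qed

section \<open>Formal WKB series\<close>

type_synonym qbar = "rat alg_closure"

type_synonym K = "qbar puiseux"

text \<open>
  The amplitude \<open>A(n, u, q)\<close> is a polynomial in \<open>n\<close> whose coefficients are formal power series;
  the variable of these power series stands for \<open>u\<^bsup>1/r\<^esup>\<close> with \<open>r = wkb_ram\<close>.
\<close>

record wkb =
  wkb_gamma :: rat
  wkb_lambda :: K
  wkb_ram :: nat
  wkb_amp :: "K fps poly"

definition wkb_phi :: "wkb \<Rightarrow> nat \<Rightarrow> nat \<Rightarrow> K" where
  "wkb_phi \<tau> i k = fps_nth (coeff (wkb_amp \<tau>) i) k"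

definition wkb_bound :: "wkb \<Rightarrow> rat \<Rightarrow> bool" where
  "wkb_bound \<tau> c \<longleftrightarrow> (\<forall>i k. wkb_phi \<tau> i k \<noteq> 0 \<longrightarrow> puiseux_deg (wkb_phi \<tau> i k) \<ge> c * of_nat k)"

definition formal_wkb :: "wkb \<Rightarrow> bool" where
  "formal_wkb \<tau> \<longleftrightarrow>
     wkb_ram \<tau> \<ge> 1 \<and>
     wkb_lambda \<tau> \<in> laurent_root (wkb_ram \<tau>) \<and>
     (\<forall>i k. wkb_phi \<tau> i k \<in> laurent_root (wkb_ram \<tau>)) \<and>
     wkb_phi \<tau> 0 0 = 1 \<and>
     (\<exists>c. wkb_bound \<tau> c)"

text \<open>\<open>A(n, q\<^sup>n, q)\<close>: here \<open>u\<^bsup>k/r\<^esup>\<close> becomes \<open>q\<^bsup>nk/r\<^esup>\<close>.\<close>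

definition wkb_amp_eval :: "wkb \<Rightarrow> nat \<Rightarrow> K" where
  "wkb_amp_eval \<tau> n = puiseux_suminf (\<lambda>k.
     fps_nth (poly (wkb_amp \<tau>) (of_nat n)) k * q_powr (of_nat n * of_nat k / of_nat (wkb_ram \<tau>)))"

definition wkb_eval :: "wkb \<Rightarrow> nat \<Rightarrow> K" where
  "wkb_eval \<tau> n = q_powr (wkb_gamma \<tau> * of_nat n ^ 2) * wkb_lambda \<tau> ^ n * wkb_amp_eval \<tau> n"

lemma puiseux_nth_times_of_nat: "puiseux_nth (f * of_nat m) x = puiseux_nth f x * of_nat m"
  by (induction m) (simp_all add: algebra_simps)

lemma puiseux_nth_sum:
  "puiseux_nth (\<Sum>i\<in>I. f i :: 'a::field puiseux) x = (\<Sum>i\<in>I. puiseux_nth (f i) x)"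
  by (induction I rule: infinite_finite_induct) simp_all

lemma fps_nth_poly_wkb_amp:
  "fps_nth (poly (wkb_amp \<tau>) (of_nat n)) k =
     (\<Sum>i\<le>degree (wkb_amp \<tau>). wkb_phi \<tau> i k * of_nat n ^ i)"
proof -
  have "fps_nth (f * of_nat n ^ i) k = fps_nth f k * of_nat n ^ i" for f :: "K fps" and i
    using fps_mult_right_const_nth[of f "of_nat (n ^ i)" k] unfolding fps_of_nat unfolding of_nat_power .
  thus ?thesis by (simp add: poly_altdef fps_sum_nth wkb_phi_def)
qed

text \<open>The evaluation is well defined for \<open>n > -rc\<close>: its coefficients are given by finite sums.\<close>

lemma wkb_amp_eval_well_defined:
  fixes n :: nat and \<tau> :: wkb
  assumes \<tau>: "formal_wkb \<tau>" and c: "wkb_bound \<tau> c" and n: "of_nat n > - of_nat (wkb_ram \<tau>) * c"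
  defines "t \<equiv> \<lambda>k x. \<Sum>i\<le>degree (wkb_amp \<tau>).
     puiseux_nth (wkb_phi \<tau> i k) (x - of_nat n * of_nat k / of_nat (wkb_ram \<tau>)) * of_nat n ^ i"
  shows "finite {k. t k x \<noteq> 0}"
    and "puiseux_nth (wkb_amp_eval \<tau> n) x = (\<Sum>k | t k x \<noteq> 0. t k x)"
proof -
  define r where "r = wkb_ram \<tau>"
  define g where "g k = fps_nth (poly (wkb_amp \<tau>) (of_nat n)) k *
    q_powr (of_nat n * of_nat k / of_nat r)" for k
  have r: "r \<ge> 1" using \<tau> by (simp add: formal_wkb_def r_def)
  have t: "puiseux_nth (g k) x = t k x" for k x
    by (simp only: g_def r_def t_def puiseux_nth_times_q_powr fps_nth_poly_wkb_amp puiseux_nth_sum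
        of_nat_power[symmetric] puiseux_nth_times_of_nat)
  have "0 < of_nat n + of_nat r * c" using n unfolding r_def by linarith
  hence "0 < (of_nat n + of_nat r * c) / of_nat r" using r by (intro divide_pos_pos) auto
  also have "\<dots> = c + of_nat n / of_nat r" using r by (simp add: add_divide_distrib)
  finally have d: "c + of_nat n / of_nat r > 0" .
  have "of_nat r * x \<in> \<int> \<and> of_nat k * (c + of_nat n / of_nat r) \<le> x"
    if "puiseux_nth (g k) x \<noteq> 0" for k x
  proof -
    define y where "y = x - of_nat n * of_nat k / of_nat r"
    have "(\<Sum>i\<le>degree (wkb_amp \<tau>). puiseux_nth (wkb_phi \<tau> i k) y * of_nat n ^ i) \<noteq> 0"
      using that unfolding t t_def y_def r_def .
    then obtain i where "puiseux_nth (wkb_phi \<tau> i k) y * of_nat n ^ i \<noteq> 0"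
      by (rule sum.not_neutral_contains_not_neutral)
    hence nz: "puiseux_nth (wkb_phi \<tau> i k) y \<noteq> 0" by auto
    hence nz': "wkb_phi \<tau> i k \<noteq> 0" by auto
    have "wkb_phi \<tau> i k \<in> laurent_root r" using \<tau> by (simp add: formal_wkb_def r_def)
    hence Y: "of_nat r * y \<in> \<int>" using nz unfolding laurent_root_iff[OF r] by blast
    have "c * of_nat k \<le> y"
      using c nz' puiseux_deg_le[OF nz' nz] unfolding wkb_bound_def by (meson order.trans)
    moreover have "of_nat r * x = of_nat r * y + of_nat (n * k)"
      using r by (simp add: y_def algebra_simps)
    ultimately show ?thesis using Y r by (simp add: y_def algebra_simps)
  qed
  note * = puiseux_nth_suminf[OF r d, of g, OF this]
  have "wkb_amp_eval \<tau> n = puiseux_suminf g"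
    unfolding wkb_amp_eval_def g_def r_def ..
  thus "finite {k. t k x \<noteq> 0}" "puiseux_nth (wkb_amp_eval \<tau> n) x = (\<Sum>k | t k x \<noteq> 0. t k x)"
    using *[of x] unfolding t by simp_all
qed

section \<open>Quasi-polynomials and linear recursions\<close>

definition periodic :: "(nat \<Rightarrow> 'a) \<Rightarrow> bool" where
  "periodic f \<longleftrightarrow> (\<exists>T>0. \<forall>n. f (n + T) = f n)"

definition quadratic_quasi_polynomial :: "(nat \<Rightarrow> rat) \<Rightarrow> bool" where
  "quadratic_quasi_polynomial p \<longleftrightarrow>
     (\<exists>d c. (\<forall>j\<le>d. periodic (c j)) \<and> (\<forall>n. p n = (\<Sum>j\<le>d. c j n * of_nat n ^ j)) \<and>
        (\<forall>j\<le>d. j > 2 \<longrightarrow> c j = (\<lambda>_. 0)))"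

definition eventually_linear_recursive :: "(nat \<Rightarrow> 'a::field) \<Rightarrow> bool" where
  "eventually_linear_recursive s \<longleftrightarrow>
     (\<exists>d a. eventually (\<lambda>n. s (n + d) = (\<Sum>j<d. a j * s (n + j))) sequentially)"

end

theory Submission
  imports Defs
begin

text \<open>
  Factor \<open>\<lambda>(q) = q\<^sup>\<beta> \<nu>(q)\<close> with \<open>\<nu>\<close> of degree 0 and leading coefficient \<open>\<alpha>\<close>. Every coefficient
  of \<open>\<nu>(q)\<^sup>n\<close> is \<open>\<alpha>\<^sup>n\<close> times a polynomial in \<open>n\<close>, so the terms that share the same \<open>\<gamma>\<close> add up to
  \<open>q\<^bsup>\<gamma> n\<^sup>2\<^esup> \<Sum> S\<^sub>b\<^sub>,\<^sub>x(n) q\<^bsup>b n + x\<^esup>\<close>, where \<open>(b, x)\<close> runs over lattice points, \<open>b\<close> is bounded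
  below, \<open>x\<close> is at least a linear function of \<open>b\<close>, and each \<open>S\<^sub>b\<^sub>,\<^sub>x\<close> is an exponential polynomial
  with bases among the \<open>\<alpha>\<close>'s. By the Skolem-Mahler-Lech theorem, with a period that depends only on
  the bases, on each residue class every \<open>S\<^sub>b\<^sub>,\<^sub>x\<close> is either identically 0 or nonzero for all large
  \<open>n\<close>; the lexicographically first \<open>(b, x)\<close> of the second kind gives the leading term, and the
  smallest \<open>\<gamma>\<close> with a nonzero sum dominates the others.

  The Skolem-Mahler-Lech theorem is proved by Hansel's method. For a suitable prime \<open>p\<close> and period
  \<open>T\<close> one has \<open>\<alpha>\<^sup>T = 1 + p\<^sup>2 \<beta>\<close> with \<open>\<beta>\<close> integral, up to a common denominator. Binomial expansion
  then shows that a rational linear functional of the sequence on a residue class modulo \<open>T\<close> agrees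
  on every initial segment with a polynomial whose \<open>j\<close>-th coefficient is divisible by \<open>p\<^sup>j\<close>.
  Dividing out \<open>k\<close> zeros makes all its values divisible by \<open>p\<^sup>k\<close>, so infinitely many zeros force
  it to vanish.
\<close>

section \<open>Functions interpolated by p-adically small polynomials\<close>

text \<open>The ideal \<open>p\<^sup>k \<int>\<^sub>(\<^sub>p\<^sub>)\<close> of the localization of the integers at \<open>p\<close>.\<close>

definition padic :: "int \<Rightarrow> nat \<Rightarrow> rat set" where
  "padic p k = {x. \<exists>a b. \<not> p dvd b \<and> of_int b * x = of_int (p ^ k * a)}"

lemma padicI: "\<not> p dvd b \<Longrightarrow> of_int b * x = of_int (p ^ k * a) \<Longrightarrow> x \<in> padic p k"
  unfolding padic_def by blast

lemma padic_add:
  assumes p: "prime p" and "x \<in> padic p k" "y \<in> padic p k"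
  shows "x + y \<in> padic p k"
proof -
  obtain a b c d where *: "\<not> p dvd b" "of_int b * x = of_int (p ^ k * a)"
    "\<not> p dvd d" "of_int d * y = of_int (p ^ k * c)"
    using assms(2,3) unfolding padic_def by blast
  have "of_int (b * d) * (x + y) = of_int d * (of_int b * x) + of_int b * (of_int d * y)"
    by (simp add: algebra_simps)
  also have "\<dots> = of_int (p ^ k * (d * a + b * c))"
    unfolding * by (simp add: algebra_simps)
  finally show ?thesis by (rule padicI[rotated]) (use * p in \<open>auto simp: prime_dvd_mult_iff\<close>)
qed

lemma padic_mult:
  assumes p: "prime p" and "x \<in> padic p k" "y \<in> padic p l"
  shows "x * y \<in> padic p (k + l)"
proof -
  obtain a b c d where *: "\<not> p dvd b" "of_int b * x = of_int (p ^ k * a)"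
    "\<not> p dvd d" "of_int d * y = of_int (p ^ l * c)"
    using assms(2,3) unfolding padic_def by blast
  have "of_int (b * d) * (x * y) = (of_int b * x) * (of_int d * y)"
    by (simp add: algebra_simps)
  also have "\<dots> = of_int (p ^ (k + l) * (a * c))"
    unfolding * by (simp add: algebra_simps power_add)
  finally show ?thesis by (rule padicI[rotated]) (use * p in \<open>auto simp: prime_dvd_mult_iff\<close>)
qed

lemma padic_antimono: "l \<le> k \<Longrightarrow> padic p k \<subseteq> padic p l"
proof
  fix x assume "l \<le> k" "x \<in> padic p k"
  then obtain a b where *: "\<not> p dvd b" "of_int b * x = of_int (p ^ k * a)"
    unfolding padic_def by blast
  have "p ^ k = p ^ l * p ^ (k - l)" using \<open>l \<le> k\<close> by (simp flip: power_add)
  thus "x \<in> padic p l" using * by (intro padicI[of p b x l "p ^ (k - l) * a"]) (simp_all add: mult.assoc)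
qed

lemma padic_of_int: "prime p \<Longrightarrow> of_int (p ^ k * a) \<in> padic p k" for p :: int
  using not_prime_unit[of p] by (intro padicI[of p 1 _ _ a]) auto

lemma padic_0 [simp]: "prime p \<Longrightarrow> 0 \<in> padic p k" for p :: int
  using padic_of_int[of p k 0] by simp

lemma padic_int [simp]: "prime p \<Longrightarrow> of_int a \<in> padic p 0" for p :: int
  using padic_of_int[of p 0 a] by simp

lemma padic_sum:
  "prime p \<Longrightarrow> (\<And>i. i \<in> I \<Longrightarrow> f i \<in> padic p k) \<Longrightarrow> sum f I \<in> padic p k" for p :: int
  by (induction I rule: infinite_finite_induct) (auto intro: padic_add)

text \<open>A nonzero \<open>i / j\<close> in \<open>padic p k\<close> forces \<open>p ^ k\<close>
  to divide \<open>i\<close>, which fails once \<open>k\<close> exceeds the multiplicity of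
  \<open>p\<close> in \<open>i\<close>.\<close>

lemma padic_Inter:
  fixes p :: int
  assumes p: "prime p" and x: "\<And>k. x \<in> padic p k"
  shows "x = 0"
proof (rule ccontr)
  assume "x \<noteq> 0"
  obtain i j where ij: "quotient_of x = (i, j)" by force
  hence j: "j > 0" and xx: "x = of_int i / of_int j"
    by (auto dest: quotient_of_denom_pos quotient_of_div)
  have i: "i \<noteq> 0" using \<open>x \<noteq> 0\<close> xx by auto
  define k where "k = Suc (multiplicity p i)"
  obtain a b where *: "\<not> p dvd b" "of_int b * x = of_int (p ^ k * a)"
    using x[of k] unfolding padic_def by blast
  have "of_int (b * i) = (of_int (p ^ k * a * j) :: rat)"
    using *(2) j unfolding xx by (simp add: field_simps)
  hence "b * i = p ^ k * (a * j)" unfolding of_int_eq_iff by (simp add: mult.assoc)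
  hence "p ^ k dvd b * i" by simp
  moreover have "coprime (p ^ k) b"
    using p *(1) by (simp add: prime_imp_coprime)
  ultimately have "p ^ k dvd i" by (simp add: coprime_dvd_mult_right_iff)
  moreover have "finite {n. p ^ n dvd i}" using p i
    by (metis finite_divisor_powers not_prime_unit)
  ultimately have "k \<le> multiplicity p i"
    using i p by (intro multiplicity_geI) (auto simp: not_prime_unit)
  thus False by (simp add: k_def)
qed

section \<open>Powers of p in factorials\<close>

lemma fact_prime_part:
  fixes p :: int
  assumes p: "prime p"
  shows "\<exists>u. \<not> p dvd u \<and> (fact i :: int) = p ^ (i div nat p) * fact (i div nat p) * u"
proof (induction i)
  case 0
  show ?case using p not_prime_unit[of p] by (intro exI[of _ 1]) auto
next
  case (Suc i)
  have p0: "nat p > 0" "int (nat p) = p" using prime_gt_0_int[OF p] by auto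
  obtain u where u: "\<not> p dvd u" "(fact i :: int) = p ^ (i div nat p) * fact (i div nat p) * u"
    using Suc by blast
  show ?case
  proof (cases "nat p dvd Suc i")
    case False
    hence "Suc i div nat p = i div nat p"
      using p0 by (simp add: div_Suc dvd_eq_mod_eq_0)
    moreover have "\<not> p dvd int (Suc i)" using False p0 by (metis int_dvd_int_iff)
    ultimately show ?thesis using u p
      by (intro exI[of _ "int (Suc i) * u"]) (auto simp: prime_dvd_mult_iff simp del: of_nat_Suc simp: fact_Suc)
  next
    case True
    \<comment> \<open>The new multiple \<open>p * m\<close> adds one factor \<open>p\<close>, while
      its cofactor \<open>m\<close> extends the factorial of \<open>i div nat p\<close>.\<close>
    then obtain m where m: "Suc i = nat p * m" by (elim dvdE)
    have "Suc i mod nat p = 0" using True by simp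
    hence "Suc i div nat p = Suc (i div nat p)" by (simp add: div_Suc)
    hence d: "Suc (i div nat p) = m" using m p0 by simp
    have s: "int (Suc i) = p * int m" using m p0 by (metis of_nat_mult)
    have "(fact (Suc i) :: int) = p * int m * fact i" unfolding fact_Suc s[symmetric] by simp
    also have "\<dots> = p ^ Suc (i div nat p) * fact (Suc (i div nat p)) * u"
      unfolding u(2) d[symmetric] fact_Suc by simp
    finally show ?thesis using u(1) \<open>Suc i div nat p = Suc (i div nat p)\<close> by metis
  qed
qed

text \<open>Legendre's recursion: the multiples of \<open>p\<close> up to \<open>i\<close>
  contribute \<open>m = i div nat p\<close> factors \<open>p\<close> and then \<open>fact m\<close>.
  By induction the exponent is at most \<open>m + m\<close>, hence at most \<open>i\<close> because
  \<open>p\<close> is at least 2.\<close>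

lemma fact_multiplicity_le:
  fixes p :: int
  assumes p: "prime p"
  shows "\<exists>v u. v \<le> i \<and> \<not> p dvd u \<and> (fact i :: int) = p ^ v * u"
proof (induction i rule: less_induct)
  case (less i)
  have p2: "nat p \<ge> 2" using prime_ge_2_int[OF p] by simp
  define m where "m = i div nat p"
  obtain u where u: "\<not> p dvd u" "(fact i :: int) = p ^ m * fact m * u"
    using fact_prime_part[OF p, of i] unfolding m_def by blast
  show ?case
  proof (cases "i = 0")
    case True
    thus ?thesis using p not_prime_unit[of p] by (intro exI[of _ 0] exI[of _ 1]) auto
  next
    case False
    hence "m < i" using p2 unfolding m_def by simp
    then obtain v w where vw: "v \<le> m" "\<not> p dvd w" "(fact m :: int) = p ^ v * w"
      using less by blast
    have "m * 2 \<le> m * nat p" using p2 by (rule mult_left_mono) simp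
    also have "\<dots> \<le> i" unfolding m_def by simp
    finally have "m + v \<le> i" using vw(1) by linarith
    moreover have "(fact i :: int) = p ^ (m + v) * (w * u)"
      unfolding u(2) vw(3) by (simp add: power_add algebra_simps)
    moreover have "\<not> p dvd w * u" using vw u p by (auto simp: prime_dvd_mult_iff)
    ultimately show ?thesis by blast
  qed
qed

text \<open>The factorial removes at most \<open>i\<close> of the \<open>2 * i\<close> factors.
  Working modulo \<open>p\<^sup>2\<close> instead of \<open>p\<close> leaves \<open>i\<close> of
  them for every prime, including 2.\<close>

lemma padic_sq_power_div_fact:
  fixes p :: int
  assumes p: "prime p"
  shows "of_int p ^ (2 * i) / fact i \<in> padic p i"
proof -
  obtain v u where u: "v \<le> i" "\<not> p dvd u" "(fact i :: int) = p ^ v * u"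
    using fact_multiplicity_le[OF p] by blast
  have f: "(fact i :: rat) = of_int (p ^ v * u)" unfolding u(3)[symmetric] by simp
  have "p ^ (2 * i) = p ^ v * p ^ (2 * i - v)" using u(1) by (simp flip: power_add)
  moreover have "p ^ (2 * i - v) = p ^ i * p ^ (i - v)" using u(1) by (simp flip: power_add add: mult_2)
  ultimately have "p ^ (2 * i) = p ^ v * (p ^ i * p ^ (i - v))" by simp
  hence "of_int p ^ (2 * i) = (of_int (p ^ v * (p ^ i * p ^ (i - v))) :: rat)" by (metis of_int_power)
  moreover have "of_int p \<noteq> (0::rat)" using p by auto
  ultimately have "of_int u * (of_int p ^ (2 * i) / fact i) = (of_int (p ^ i * p ^ (i - v)) :: rat)"
    using u(2) unfolding f by auto
  thus ?thesis using u(2) by (intro padicI) auto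
qed

text \<open>Because the exponent grows with \<open>j\<close>, dividing by an integer root gains a
  factor \<open>p\<close>; the offset \<open>s\<close> counts the roots already divided out.\<close>

definition padic_poly :: "int \<Rightarrow> nat \<Rightarrow> rat poly \<Rightarrow> bool" where
  "padic_poly p s R \<longleftrightarrow> (\<forall>j. coeff R j \<in> padic p (j + s))"

text \<open>Each initial segment has its own polynomial; this takes the place of a convergent power
  series over the \<open>p\<close>-adic numbers.\<close>

definition padic_analytic :: "int \<Rightarrow> (nat \<Rightarrow> rat) \<Rightarrow> bool" where
  "padic_analytic p b \<longleftrightarrow> (\<forall>N. \<exists>R. padic_poly p 0 R \<and> (\<forall>t\<le>N. b t = poly R (of_nat t)))"

text \<open>Synthetic division from the top: coefficient \<open>n\<close> of \<open>Q\<close> is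
  coefficient \<open>Suc n\<close> of the product plus \<open>t\<close> times coefficient
  \<open>Suc n\<close> of \<open>Q\<close>. The index shift is the gain in \<open>s\<close>.\<close>

lemma padic_poly_divide_root:
  fixes p :: int
  assumes p: "prime p" and R: "padic_poly p s ([:- of_int t, 1:] * Q)"
  shows "padic_poly p (Suc s) Q"
proof -
  have "coeff Q j \<in> padic p (j + Suc s)" for j
  proof (cases "j \<le> degree Q")
    case True
    thus ?thesis
    proof (induction rule: inc_induct)
      case base
      have "coeff ([:- of_int t, 1:] * Q) (Suc (degree Q)) = coeff Q (degree Q)"
        by (simp add: coeff_pCons coeff_eq_0)
      thus ?case using R unfolding padic_poly_def by (metis add_Suc add_Suc_right)
    next
      case (step n)
      have "coeff ([:- of_int t, 1:] * Q) (Suc n) = coeff Q n - of_int t * coeff Q (Suc n)"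
        by (simp add: coeff_pCons)
      hence "coeff Q n = coeff ([:- of_int t, 1:] * Q) (Suc n) + of_int t * coeff Q (Suc n)" by simp
      moreover have "coeff ([:- of_int t, 1:] * Q) (Suc n) \<in> padic p (n + Suc s)"
        using R unfolding padic_poly_def by (metis add_Suc add_Suc_right)
      moreover have "of_int t * coeff Q (Suc n) \<in> padic p (0 + (Suc n + Suc s))"
        by (intro padic_mult p padic_int step)
      hence "of_int t * coeff Q (Suc n) \<in> padic p (n + Suc s)"
        using padic_antimono[of "n + Suc s" "0 + (Suc n + Suc s)"] by auto
      ultimately show ?case using p by (metis padic_add)
    qed
  qed (use p in \<open>simp add: coeff_eq_0\<close>)
  thus ?thesis unfolding padic_poly_def by blast
qed

lemma poly_padic:
  fixes p :: int
  assumes p: "prime p" and R: "padic_poly p s R"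
  shows "poly R (of_nat t) \<in> padic p s"
  unfolding poly_altdef
proof (rule padic_sum[OF p])
  fix i
  have "coeff R i * of_int (int t ^ i) \<in> padic p (i + s + 0)"
    using R p unfolding padic_poly_def by (intro padic_mult padic_int) auto
  thus "coeff R i * of_nat t ^ i \<in> padic p s"
    using padic_antimono[of s "i + s + 0"] by auto
qed

text \<open>Every root divided out raises \<open>s\<close> by one, and the removed factors take
  integer values at \<open>t\<close>.\<close>

lemma padic_poly_many_roots:
  fixes p :: int
  assumes p: "prime p" and "finite F" and "padic_poly p s R"
    and "\<And>t::nat. t \<in> F \<Longrightarrow> poly R (of_nat t) = 0"
  shows "poly R (of_nat t) \<in> padic p (s + card F)"
  using assms(2-)
proof (induction F arbitrary: s R rule: finite_induct)
  case empty
  thus ?case using poly_padic[OF p] by simp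
next
  case (insert x F)
  have "poly R (of_nat x) = 0" using insert by auto
  then obtain Q where Q: "R = [:- of_nat x, 1:] * Q" unfolding poly_eq_0_iff_dvd by (elim dvdE)
  have "padic_poly p (Suc s) Q"
    using insert.prems(1) padic_poly_divide_root[OF p, of s "int x" Q] unfolding Q by simp
  moreover have "poly Q (of_nat t) = 0" if "t \<in> F" for t
  proof -
    have "poly R (of_nat t) = 0" using insert that by auto
    thus ?thesis using insert.hyps that unfolding Q by auto
  qed
  ultimately have "poly Q (of_nat t) \<in> padic p (Suc s + card F)" by (rule insert.IH)
  hence "of_int (int t - int x) * poly Q (of_nat t) \<in> padic p (0 + (Suc s + card F))"
    by (intro padic_mult padic_int p)
  moreover have "poly R (of_nat t) = of_int (int t - int x) * poly Q (of_nat t)"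
    unfolding Q by (simp add: algebra_simps)
  ultimately show ?case using insert.hyps by simp
qed

text \<open>For any \<open>k\<close>, one polynomial interpolates \<open>b\<close> at
  \<open>k\<close> of its zeros and at \<open>t\<close>. Its value at \<open>t\<close> then lies in
  \<open>padic p k\<close>, and only 0 does so for all \<open>k\<close>.\<close>

lemma padic_analytic_zero:
  fixes p :: int
  assumes p: "prime p" and b: "padic_analytic p b" and inf: "infinite {t. b t = 0}"
  shows "b t = 0"
proof (rule padic_Inter[OF p])
  fix k
  obtain F where F: "F \<subseteq> {t. b t = 0}" "finite F" "card F = k"
    using infinite_arbitrarily_large[OF inf] by blast
  define N where "N = Max (insert t F)"
  have N: "u \<le> N" if "u \<in> insert t F" for u using that F unfolding N_def by (intro Max_ge) auto
  obtain R where R: "padic_poly p 0 R" "\<And>t. t \<le> N \<Longrightarrow> b t = poly R (of_nat t)"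
    using b unfolding padic_analytic_def by blast
  have "poly R (of_nat t) \<in> padic p (0 + card F)"
    by (rule padic_poly_many_roots[OF p F(2) R(1)]) (use F N R in auto)
  thus "b t \<in> padic p k" using R(2) N F by simp
qed

section \<open>Closure of p-adic interpolation under ring operations\<close>

lemma padic_poly_add:
  "prime p \<Longrightarrow> padic_poly p s Q \<Longrightarrow> padic_poly p s R \<Longrightarrow> padic_poly p s (Q + R)" for p :: int
  unfolding padic_poly_def by (auto intro: padic_add)

lemma padic_poly_mult:
  assumes p: "prime p" and "padic_poly p s Q" "padic_poly p t R"
  shows "padic_poly p (s + t) (Q * R)"
  unfolding padic_poly_def coeff_mult
proof (intro allI padic_sum[OF p])
  fix j i :: nat assume "i \<in> {..j}"
  moreover have "coeff Q i * coeff R (j - i) \<in> padic p ((i + s) + (j - i + t))"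
    using assms unfolding padic_poly_def by (intro padic_mult) auto
  ultimately show "coeff Q i * coeff R (j - i) \<in> padic p (j + (s + t))"
    by (simp add: algebra_simps)
qed

lemma padic_poly_sum:
  assumes "prime p"
  shows "(\<And>i. i \<in> I \<Longrightarrow> padic_poly p s (f i)) \<Longrightarrow> padic_poly p s (sum f I)"
  using assms by (induction I rule: infinite_finite_induct) (auto intro: padic_poly_add, auto simp: padic_poly_def)

lemma padic_analytic_add:
  assumes p: "prime p" and "padic_analytic p a" "padic_analytic p b"
  shows "padic_analytic p (\<lambda>n. a n + b n)"
  unfolding padic_analytic_def
proof
  fix N
  obtain Q R where "padic_poly p 0 Q" "\<forall>t\<le>N. a t = poly Q (of_nat t)"
     "padic_poly p 0 R" "\<forall>t\<le>N. b t = poly R (of_nat t)"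
    using assms(2,3) unfolding padic_analytic_def by metis
  thus "\<exists>R. padic_poly p 0 R \<and> (\<forall>t\<le>N. a t + b t = poly R (of_nat t))"
    using p by (intro exI[of _ "Q + R"]) (auto intro: padic_poly_add)
qed

lemma padic_analytic_mult:
  assumes p: "prime p" and "padic_analytic p a" "padic_analytic p b"
  shows "padic_analytic p (\<lambda>n. a n * b n)"
  unfolding padic_analytic_def
proof
  fix N
  obtain Q R where "padic_poly p 0 Q" "\<forall>t\<le>N. a t = poly Q (of_nat t)"
     "padic_poly p 0 R" "\<forall>t\<le>N. b t = poly R (of_nat t)"
    using assms(2,3) unfolding padic_analytic_def by metis
  thus "\<exists>R. padic_poly p 0 R \<and> (\<forall>t\<le>N. a t * b t = poly R (of_nat t))"
    using padic_poly_mult[OF p, of 0 Q 0 R] by (intro exI[of _ "Q * R"]) auto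
qed

lemma padic_analytic_const: "prime p \<Longrightarrow> padic_analytic p (\<lambda>_. of_int a)"
  unfolding padic_analytic_def padic_poly_def
  by (intro allI exI[of _ "[:of_int a:]"]) (auto simp: coeff_pCons split: nat.splits)

lemma padic_analytic_linear: "prime p \<Longrightarrow> padic_analytic p (\<lambda>n. of_int (p * (a + c * int n)))"
  unfolding padic_analytic_def padic_poly_def
  using padic_of_int[of p 1 c] padic_int[of p "p * a"]
  by (intro allI exI[of _ "[:of_int (p * a), of_int (p * c):]"])
     (auto simp: coeff_pCons algebra_simps simp del: padic_int split: nat.splits)

lemma padic_analytic_power:
  assumes "prime p" "padic_analytic p a" shows "padic_analytic p (\<lambda>n. a n ^ k)"
  using assms padic_analytic_const[of p 1] by (induction k) (auto intro: padic_analytic_mult)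

section \<open>Binomial sums with p-adically small coefficients\<close>

definition binomial_poly :: "nat \<Rightarrow> 'a::field_char_0 poly" where
  "binomial_poly i = smult (1 / fact i) (\<Prod>l<i. [:- of_nat l, 1:])"

lemma poly_binomial_poly: "poly (binomial_poly i) (of_nat n) = of_nat (n choose i)"
  by (simp add: binomial_poly_def poly_prod binomial_gbinomial gbinomial_prod_rev field_simps atLeast0LessThan)

text \<open>Apart from the denominator \<open>fact i\<close>, the binomial polynomial has integer
  coefficients and degree at most \<open>i\<close>, so \<open>padic_sq_power_div_fact\<close>
  supplies enough factors \<open>p\<close> for every coefficient.\<close>

lemma padic_poly_binomial:
  assumes p: "prime p"
  shows "padic_poly p 0 (smult (of_int (p ^ (2 * i) * d)) (binomial_poly i))"
proof -
  define G :: "rat poly" where "G = (\<Prod>l<i. [:- of_nat l, 1:])"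
  have deg: "degree G \<le> i"
    unfolding G_def by (rule order.trans[OF degree_prod_sum_le]) auto
  have "coeff (\<Prod>l<k. [:- of_nat l, 1:] :: rat poly) j \<in> \<int>" for k j
    by (induction k arbitrary: j) (auto simp: coeff_pCons coeff_1 split: nat.splits)
  hence int: "coeff G j \<in> \<int>" for j unfolding G_def .
  have "of_int p ^ (2 * i) / fact i * (of_int d * coeff G j) \<in> padic p (j + 0)" for j
  proof (cases "j \<le> i")
    case True
    obtain z where z: "coeff G j = of_int z" using int[of j] by (auto elim: Ints_cases)
    have "of_int p ^ (2 * i) / fact i * of_int (d * z) \<in> padic p (i + 0)"
      by (intro padic_mult p padic_int padic_sq_power_div_fact)
    thus ?thesis using padic_antimono[of "j + 0" "i + 0"] True unfolding z by auto
  next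
    case False
    thus ?thesis using deg p by (simp add: coeff_eq_0)
  qed
  thus ?thesis unfolding padic_poly_def binomial_poly_def G_def[symmetric]
    by (simp add: field_simps)
qed

text \<open>For \<open>n\<close> at most \<open>N\<close> the binomial coefficients with
  \<open>i > n\<close> vanish, so the truncation at \<open>N\<close> is one polynomial valid on the
  whole segment.\<close>

lemma padic_analytic_binomial_sum:
  fixes d :: "nat \<Rightarrow> int"
  assumes p: "prime p"
  shows "padic_analytic p (\<lambda>n. \<Sum>i\<le>n. of_nat (n choose i) * of_int (p ^ (2 * i) * d i))"
  unfolding padic_analytic_def
proof
  fix N
  define R where "R = (\<Sum>i\<le>N. smult (of_int (p ^ (2 * i) * d i)) (binomial_poly i) :: rat poly)"
  have "padic_poly p 0 R" unfolding R_def by (intro padic_poly_sum p padic_poly_binomial)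
  moreover have "(\<Sum>i\<le>t. of_nat (t choose i) * of_int (p ^ (2 * i) * d i)) = poly R (of_nat t)" if "t \<le> N" for t
  proof -
    have "poly R (of_nat t) = (\<Sum>i\<le>N. of_nat (t choose i) * of_int (p ^ (2 * i) * d i))"
      unfolding R_def poly_sum by (intro sum.cong) (simp_all add: poly_binomial_poly)
    also have "\<dots> = (\<Sum>i\<le>t. of_nat (t choose i) * of_int (p ^ (2 * i) * d i))"
      using that by (intro sum.mono_neutral_right) auto
    finally show ?thesis by simp
  qed
  ultimately show "\<exists>R. padic_poly p 0 R \<and> (\<forall>t\<le>N. (\<Sum>i\<le>t. of_nat (t choose i) * of_int (p ^ (2 * i) * d i)) =
      poly R (of_nat t))" by blast
qed

section \<open>The Skolem-Mahler-Lech theorem with a uniform period\<close>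

definition ipoly :: "int poly \<Rightarrow> 'a::comm_ring_1 \<Rightarrow> 'a" where
  "ipoly Q x = poly (map_poly of_int Q) x"

lemma ipoly_0 [simp]: "ipoly 0 x = 0"
  and ipoly_1 [simp]: "ipoly 1 x = 1"
  by (simp_all add: ipoly_def)

lemma ipoly_pCons [simp]: "ipoly (pCons a Q) x = of_int a + x * ipoly Q x"
  by (simp add: ipoly_def map_poly_pCons)

lemma ipoly_add [simp]: "ipoly (P + Q) x = ipoly P x + ipoly Q x"
  by (induction P Q rule: poly_induct2) (simp_all add: algebra_simps)

lemma ipoly_smult [simp]: "ipoly (smult a Q) x = of_int a * ipoly Q x"
  by (induction Q) (simp_all add: algebra_simps)

lemma ipoly_minus [simp]: "ipoly (- Q) x = - ipoly Q x"
  by (induction Q) (simp_all add: algebra_simps)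

lemma ipoly_diff [simp]: "ipoly (P - Q) x = ipoly P x - ipoly Q x"
  using ipoly_add[of P "- Q" x] by simp

lemma ipoly_mult [simp]: "ipoly (P * Q) x = ipoly P x * ipoly Q x"
  by (induction P) (simp_all add: algebra_simps)

lemma ipoly_power [simp]: "ipoly (Q ^ n) x = ipoly Q x ^ n"
  by (induction n) simp_all

lemma ipoly_sum: "ipoly (\<Sum>i\<in>I. f i) x = (\<Sum>i\<in>I. ipoly (f i) x)"
  by (induction I rule: infinite_finite_induct) simp_all

lemma ipoly_monom: "ipoly (monom a n) x = of_int a * x ^ n"
  by (induction n) (simp_all add: monom_0 monom_Suc algebra_simps)

lemma ipoly_altdef: "ipoly Q x = (\<Sum>i\<le>degree Q. of_int (coeff Q i) * x ^ i)"
  using ipoly_sum[of "\<lambda>i. monom (coeff Q i) i" "{..degree Q}" x]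
  by (simp add: ipoly_monom poly_as_sum_of_monoms)

text \<open>Scaling by a multiple of the leading coefficient of an integer equation for
  \<open>x\<close> gives an algebraic integer. Admitting all multiples \<open>N\<close> lets one
  scaling serve finitely many bases; the nonzero constant term later restricts the choice of the
  prime.\<close>

lemma algebraic_scaled_monic:
  fixes x :: "'a::field_char_0"
  assumes "algebraic x" "x \<noteq> 0"
  obtains a :: int where "a \<noteq> 0"
    "\<And>N. a dvd N \<Longrightarrow> N \<noteq> 0 \<Longrightarrow> \<exists>Q. lead_coeff Q = 1 \<and> coeff Q 0 \<noteq> 0 \<and> ipoly Q (of_int N * x) = 0"
proof -
  obtain P where P: "P \<noteq> 0" "poly (map_poly of_int P) x = 0" "coeff P 0 \<noteq> 0"
    using algebraicE'_nonzero[OF assms] by metis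
  define d where "d = degree P"
  have "d \<noteq> 0"
  proof
    assume "d = 0"
    then obtain b where "P = [:b:]" unfolding d_def by (rule degree_eq_zeroE)
    thus False using P by (simp add: map_poly_pCons)
  qed
  define a where "a = lead_coeff P"
  show ?thesis
  proof (rule that[of a])
    show "a \<noteq> 0" using P by (simp add: a_def)
    fix N assume "a dvd N" "N \<noteq> 0"
    then obtain e where e: "N = a * e" by (elim dvdE)
    have "e \<noteq> 0" using e \<open>N \<noteq> 0\<close> by auto
    \<comment> \<open>These are the coefficients of \<open>e * N ^ (d - 1)\<close> times
      \<open>P\<close> at \<open>X / N\<close>; the leading one, \<open>a * e / N\<close>, equals
      1.\<close>
    define h where "h i = (if i = d then 1 else coeff P i * e * N ^ (d - 1 - i))" for i
    define Q where "Q = (\<Sum>i\<le>d. monom (h i) i)"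
    have cQ: "coeff Q i = (if i \<le> d then h i else 0)" for i
      unfolding Q_def coeff_sum coeff_monom by (simp add: if_distrib cong: if_cong)
    have "degree Q = d"
      by (rule antisym[OF degree_le le_degree]) (auto simp: cQ h_def)
    hence lead: "lead_coeff Q = 1" by (simp add: cQ h_def)
    have c0: "coeff Q 0 \<noteq> 0" using \<open>d \<noteq> 0\<close> \<open>e \<noteq> 0\<close> \<open>N \<noteq> 0\<close> P(3) by (simp add: cQ h_def)
    have "of_int (h i) * (of_int N * x) ^ i = of_int (e * N ^ (d - 1)) * (of_int (coeff P i) * x ^ i)"
      if "i \<le> d" for i
    proof (cases "i = d")
      case True
      obtain d' where "d = Suc d'" using \<open>d \<noteq> 0\<close> not0_implies_Suc by blast
      thus ?thesis using True unfolding h_def by (simp add: e power_mult_distrib a_def d_def[symmetric])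
    next
      case False
      hence "d - 1 = (d - 1 - i) + i" using that by simp
      hence "N ^ (d - 1) = N ^ (d - 1 - i) * N ^ i" by (metis power_add)
      hence "of_int (N ^ (d - 1)) = (of_int (N ^ (d - 1 - i)) * of_int (N ^ i) :: 'a)" by simp
      thus ?thesis using False unfolding h_def by (simp add: power_mult_distrib)
    qed
    hence "ipoly Q (of_int N * x) = (\<Sum>i\<le>d. of_int (e * N ^ (d - 1)) * (of_int (coeff P i) * x ^ i))"
      unfolding Q_def ipoly_sum ipoly_monom by (intro sum.cong) auto
    also have "\<dots> = of_int (e * N ^ (d - 1)) * ipoly P x"
      unfolding ipoly_altdef d_def sum_distrib_left ..
    also have "\<dots> = 0" using P(2) by (simp add: ipoly_def)
    finally show "\<exists>Q. lead_coeff Q = 1 \<and> coeff Q 0 \<noteq> 0 \<and> ipoly Q (of_int N * x) = 0"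
      using lead c0 by blast
  qed
qed

lemma ipoly_monic_reduce:
  fixes x :: "'a::comm_ring_1"
  assumes "lead_coeff Q = 1" "ipoly Q x = 0"
  shows "\<exists>R. ipoly P x = ipoly R x \<and> (\<forall>l\<ge>degree Q. coeff R l = 0)"
proof -
  have Q: "Q \<noteq> 0" using assms(1) by auto
  obtain S R where SR: "pseudo_divmod P Q = (S, R)" by force
  note * = pseudo_divmod[OF Q SR]
  have "P = Q * S + R" using *(1) assms(1) by simp
  hence "ipoly P x = ipoly R x" using assms(2) by simp
  moreover have "coeff R l = 0" if "l \<ge> degree Q" for l
    using *(2) that by (auto intro: coeff_eq_0)
  ultimately show ?thesis by blast
qed

text \<open>Modulo \<open>m\<close> the powers of \<open>x\<close> have finitely many coefficient
  vectors, so two of them agree. The factor \<open>x ^ i\<close> cancels because \<open>x\<close>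
  divides in Z[x] the constant term of \<open>Q\<close>, a unit modulo \<open>m\<close>.\<close>

lemma monic_root_power_cong_1:
  fixes x :: "'a::comm_ring_1" and m :: int
  assumes Q: "lead_coeff Q = 1" "ipoly Q x = 0" and cop: "coprime (coeff Q 0) m" and m: "m > 0"
  shows "\<exists>T>0. \<exists>B. x ^ T = 1 + of_int m * ipoly B x"
proof -
  define d where "d = degree Q"
  have "\<forall>i. \<exists>R. x ^ i = ipoly R x \<and> (\<forall>l\<ge>d. coeff R l = 0)"
    using ipoly_monic_reduce[OF Q, of "monom 1 _"] by (simp add: ipoly_monom d_def)
  then obtain R where R: "\<And>i. x ^ i = ipoly (R i) x" "\<And>i l. l \<ge> d \<Longrightarrow> coeff (R i) l = 0" by metis
  define f where "f i = map (\<lambda>l. coeff (R i) l mod m) [0..<d]" for i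
  have "range f \<subseteq> {xs. set xs \<subseteq> {0..<m} \<and> length xs = d}" using m by (auto simp: f_def)
  hence "finite (range f)" by (rule finite_subset) (simp add: finite_lists_length_eq)
  hence "\<not> inj f" using finite_imageD infinite_UNIV_nat by blast
  then obtain i j where ij: "f i = f j" "i < j" unfolding inj_def by (metis linorder_neqE_nat)
  define D where "D = R j - R i"
  have dvd: "m dvd coeff D l" for l
  proof (cases "l < d")
    case True
    hence "f i ! l = f j ! l" using ij by simp
    thus ?thesis using True by (simp add: f_def D_def mod_eq_dvd_iff dvd_diff_commute)
  qed (simp add: D_def R(2))
  define B where "B = map_poly (\<lambda>c. c div m) D"
  have "D = smult m B" by (rule poly_eqI) (use dvd in \<open>simp add: B_def coeff_map_poly\<close>)
  hence B: "x ^ j - x ^ i = of_int m * ipoly B x"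
    unfolding R(1) by (simp flip: ipoly_diff ipoly_smult add: D_def)
  define T where "T = j - i"
  have jT: "x ^ j = x ^ i * x ^ T" using ij by (simp add: T_def flip: power_add)
  obtain c Q1 where cQ: "Q = pCons c Q1" by (cases Q)
  have c: "coprime c m" using cop cQ by simp
  have "of_int c = - (x * ipoly Q1 x)" using Q(2) unfolding cQ by (simp add: eq_neg_iff_add_eq_0)
  hence y: "x * ipoly (- Q1) x = of_int c" by simp
  have "coprime (c ^ i) m" using c by simp
  then obtain u v where uv: "u * c ^ i + v * m = 1" by (metis bezout_int coprime_iff_gcd_eq_1)
  define Y where "Y = ipoly (- Q1) x"
  have xY: "x ^ i * Y ^ i = of_int (c ^ i)" unfolding Y_def power_mult_distrib[symmetric] y by simp
  \<comment> \<open>Bezout's identity inverts \<open>c ^ i\<close> modulo \<open>m\<close>, and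
    \<open>c ^ i\<close> factors as \<open>x ^ i * Y ^ i\<close>; the congruence for
    \<open>x ^ j - x ^ i\<close> then applies.\<close>
  have "x ^ T - 1 = of_int (u * c ^ i + v * m) * (x ^ T - 1)" unfolding uv by simp
  also have "\<dots> = of_int u * of_int (c ^ i) * (x ^ T - 1) + of_int m * (of_int v * (x ^ T - 1))"
    by (simp add: algebra_simps)
  also have "of_int u * of_int (c ^ i) * (x ^ T - 1) = of_int u * Y ^ i * (x ^ j - x ^ i)"
    unfolding xY[symmetric] jT by (simp add: algebra_simps)
  also have "\<dots> = of_int m * (of_int u * Y ^ i * ipoly B x)" unfolding B by (simp add: algebra_simps)
  finally have "x ^ T = 1 + of_int m * ipoly (smult u ((- Q1) ^ i * B) + smult v (monom 1 T - 1)) x"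
    by (simp add: Y_def ipoly_monom algebra_simps)
  moreover have "T > 0" using ij by (simp add: T_def)
  ultimately show ?thesis by blast
qed

lemma power_cong_1_mult:
  fixes x :: "'a::comm_ring_1"
  assumes "x ^ T = 1 + of_int m * ipoly B x"
  shows "\<exists>B. x ^ (T * k) = 1 + of_int m * ipoly B x"
proof (induction k)
  case 0
  show ?case by (rule exI[of _ 0]) simp
next
  case (Suc k)
  then obtain C where C: "x ^ (T * k) = 1 + of_int m * ipoly C x" by blast
  have "x ^ (T * Suc k) = (1 + of_int m * ipoly B x) * (1 + of_int m * ipoly C x)"
    unfolding mult_Suc_right power_add assms C ..
  also have "\<dots> = 1 + of_int m * ipoly (B + C + smult m (B * C)) x" by (simp add: algebra_simps)
  finally show ?case by blast
qed

section \<open>Rational linear functionals\<close>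

definition rat_linear :: "('a::field_char_0 \<Rightarrow> rat) \<Rightarrow> bool" where
  "rat_linear \<phi> \<longleftrightarrow> (\<forall>x y. \<phi> (x + y) = \<phi> x + \<phi> y) \<and> (\<forall>r x. \<phi> (of_rat r * x) = r * \<phi> x)"

text \<open>Extend \<open>x\<close> to a basis over the rationals and take its coordinate. Such
  functionals lead to rational sequences, in place of an embedding into a \<open>p\<close>-adic
  field.\<close>

lemma rat_linear_nonzero:
  fixes x :: "'a::field_char_0"
  assumes "x \<noteq> 0"
  shows "\<exists>\<phi>. rat_linear \<phi> \<and> \<phi> x \<noteq> 0"
proof -
  interpret V: vector_space "\<lambda>(r::rat) (x::'a). of_rat r * x"
    by unfold_locales (simp_all add: of_rat_add of_rat_mult algebra_simps)
  define Bas where "Bas = V.extend_basis {x}"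
  have ind: "V.independent {x}" using assms by (simp add: V.dependent_single)
  have B: "V.independent Bas" "V.span Bas = UNIV" "x \<in> Bas"
    using V.independent_extend_basis[OF ind] V.span_extend_basis[OF ind] V.extend_basis_superset[OF ind]
    unfolding Bas_def by auto
  show ?thesis
  proof (intro exI[of _ "\<lambda>v. V.representation Bas v x"] conjI)
    show "rat_linear (\<lambda>v. V.representation Bas v x)"
      unfolding rat_linear_def using B by (simp add: V.representation_add V.representation_scale)
    show "V.representation Bas x x \<noteq> 0" using B by (simp add: V.representation_basis)
  qed
qed

lemma rat_linear_add: "rat_linear \<phi> \<Longrightarrow> \<phi> (x + y) = \<phi> x + \<phi> y"
  and rat_linear_scale: "rat_linear \<phi> \<Longrightarrow> \<phi> (of_rat r * x) = r * \<phi> x"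
  by (simp_all add: rat_linear_def)

lemma rat_linear_of_int: "rat_linear \<phi> \<Longrightarrow> \<phi> (of_int r * x) = of_int r * \<phi> x"
  using rat_linear_scale[of \<phi> "of_int r" x] by simp

lemma rat_linear_0: "rat_linear \<phi> \<Longrightarrow> \<phi> 0 = 0"
  using rat_linear_scale[of \<phi> 0 0] by simp

lemma rat_linear_sum: "rat_linear \<phi> \<Longrightarrow> \<phi> (\<Sum>i\<in>I. f i) = (\<Sum>i\<in>I. \<phi> (f i))"
  by (induction I rule: infinite_finite_induct) (simp_all add: rat_linear_0 rat_linear_add)

lemma common_denominator:
  fixes f :: "nat \<Rightarrow> rat"
  shows "\<exists>M::int. M \<noteq> 0 \<and> (\<forall>l<d. of_int M * f l \<in> \<int>)"
proof (induction d)
  case (Suc d)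
  then obtain M :: int where M: "M \<noteq> 0" "\<forall>l<d. of_int M * f l \<in> \<int>" by blast
  obtain i j where ij: "quotient_of (f d) = (i, j)" by force
  hence j: "j > 0" "f d = of_int i / of_int j"
    by (auto dest: quotient_of_denom_pos quotient_of_div)
  have "of_int (M * j) * f l \<in> \<int>" if "l < Suc d" for l
  proof (cases "l = d")
    case True
    have "of_int (M * j) * f l = of_int (M * i)" using j True by simp
    thus ?thesis by (metis Ints_of_int)
  next
    case False
    hence "of_int M * f l \<in> \<int>" using M that by auto
    hence "of_int j * (of_int M * f l) \<in> \<int>" by (rule Ints_mult[OF Ints_of_int])
    thus ?thesis by (simp add: algebra_simps)
  qed
  thus ?case using M j by (intro exI[of _ "M * j"]) auto
qed (auto intro: exI[of _ 1])

text \<open>The elements \<open>c * ipoly P x\<close> are integer combinations of the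
  \<open>c * x ^ l\<close> with \<open>l < degree Q\<close>, so clearing denominators on these
  suffices.\<close>

lemma rat_linear_bounded_denominator:
  fixes x c :: "'a::field_char_0"
  assumes \<phi>: "rat_linear \<phi>" and Q: "lead_coeff Q = 1" "ipoly Q x = 0"
  shows "\<exists>M::int. M \<noteq> 0 \<and> (\<forall>P. of_int M * \<phi> (c * ipoly P x) \<in> \<int>)"
proof -
  obtain M :: int where M: "M \<noteq> 0" "\<forall>l<degree Q. of_int M * \<phi> (c * x ^ l) \<in> \<int>"
    using common_denominator[of "degree Q" "\<lambda>l. \<phi> (c * x ^ l)"] by blast
  have "of_int M * \<phi> (c * ipoly P x) \<in> \<int>" for P
  proof -
    obtain R where R: "ipoly P x = ipoly R x" "\<forall>l\<ge>degree Q. coeff R l = 0"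
      using ipoly_monic_reduce[OF Q] by blast
    have "c * ipoly P x = (\<Sum>l\<le>degree R. of_int (coeff R l) * (c * x ^ l))"
      unfolding R(1) unfolding ipoly_altdef sum_distrib_left by (simp add: algebra_simps)
    hence "\<phi> (c * ipoly P x) = (\<Sum>l\<le>degree R. of_int (coeff R l) * \<phi> (c * x ^ l))"
      by (simp only: rat_linear_sum[OF \<phi>] rat_linear_of_int[OF \<phi>])
    hence "of_int M * \<phi> (c * ipoly P x) = (\<Sum>l\<le>degree R. of_int (coeff R l) * (of_int M * \<phi> (c * x ^ l)))"
      by (simp add: sum_distrib_left algebra_simps)
    also have "\<dots> \<in> \<int>"
    proof (rule Ints_sum)
      fix l
      show "of_int (coeff R l) * (of_int M * \<phi> (c * x ^ l)) \<in> \<int>"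
        using M R(2) by (cases "l < degree Q") (auto intro: Ints_mult)
    qed
    finally show ?thesis .
  qed
  thus ?thesis using M by blast
qed

text \<open>A nonzero integer factor keeps the zeros; it absorbs the denominators of a functional
  and the powers of \<open>p\<close> that make polynomials in \<open>n\<close> small.\<close>

definition scaled_analytic :: "int \<Rightarrow> (nat \<Rightarrow> rat) \<Rightarrow> bool" where
  "scaled_analytic p b \<longleftrightarrow> (\<exists>M::int. M \<noteq> 0 \<and> padic_analytic p (\<lambda>n. of_int M * b n))"

lemma scaled_analytic_add:
  assumes p: "prime p" and "scaled_analytic p a" "scaled_analytic p b"
  shows "scaled_analytic p (\<lambda>n. a n + b n)"
proof -
  obtain M N where M: "M \<noteq> 0" "padic_analytic p (\<lambda>n. of_int M * a n)"
     "N \<noteq> 0" "padic_analytic p (\<lambda>n. of_int N * b n)"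
    using assms(2,3) unfolding scaled_analytic_def by blast
  have "padic_analytic p (\<lambda>n. of_int N * (of_int M * a n) + of_int M * (of_int N * b n))"
    by (rule padic_analytic_add[OF p padic_analytic_mult[OF p padic_analytic_const M(2)]
          padic_analytic_mult[OF p padic_analytic_const M(4)]]) (fact p)+
  hence "padic_analytic p (\<lambda>n. of_int (M * N) * (a n + b n))" by (simp add: algebra_simps)
  thus ?thesis unfolding scaled_analytic_def using M by (intro exI[of _ "M * N"]) auto
qed

lemma scaled_analytic_mult:
  assumes p: "prime p" and "scaled_analytic p a" "scaled_analytic p b"
  shows "scaled_analytic p (\<lambda>n. a n * b n)"
proof -
  obtain M N where M: "M \<noteq> 0" "padic_analytic p (\<lambda>n. of_int M * a n)"
     "N \<noteq> 0" "padic_analytic p (\<lambda>n. of_int N * b n)"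
    using assms(2,3) unfolding scaled_analytic_def by blast
  have "padic_analytic p (\<lambda>n. (of_int M * a n) * (of_int N * b n))"
    by (rule padic_analytic_mult[OF p M(2,4)])
  hence "padic_analytic p (\<lambda>n. of_int (M * N) * (a n * b n))" by (simp add: algebra_simps)
  thus ?thesis unfolding scaled_analytic_def using M by (intro exI[of _ "M * N"]) auto
qed

lemma scaled_analytic_sum:
  assumes "prime p"
  shows "(\<And>i. i \<in> I \<Longrightarrow> scaled_analytic p (f i)) \<Longrightarrow> scaled_analytic p (\<lambda>n. \<Sum>i\<in>I. f i n)"
proof (induction I rule: infinite_finite_induct)
  case (insert x F)
  thus ?case using scaled_analytic_add[OF assms, of "f x" "\<lambda>n. \<Sum>i\<in>F. f i n"] by simp
qed (use padic_analytic_const[OF assms, of 0] in \<open>auto simp: scaled_analytic_def intro: exI[of _ 1]\<close>)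

lemma scaled_analytic_progression_power:
  assumes p: "prime p"
  shows "scaled_analytic p (\<lambda>n. of_nat (r + T * n) ^ j)"
proof -
  have "padic_analytic p (\<lambda>n. of_int (p * (int r + int T * int n)) ^ j)"
    by (intro padic_analytic_power padic_analytic_linear p)
  hence "padic_analytic p (\<lambda>n. of_int (p ^ j) * of_nat (r + T * n) ^ j)"
    by (simp add: power_mult_distrib)
  thus ?thesis using p unfolding scaled_analytic_def by (intro exI[of _ "p ^ j"]) auto
qed

text \<open>Expand \<open>x ^ (T * n)\<close> as the \<open>n\<close>-th power of
  \<open>1 + p\<^sup>2 * ipoly B x\<close>. Term \<open>i\<close> carries
  \<open>p ^ (2 * i)\<close>, and the functional sends the remaining factor to a rational whose
  denominator divides a fixed \<open>M\<close>.\<close>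

lemma scaled_analytic_power:
  fixes x c :: "'a::field_char_0"
  assumes p: "prime p" and \<phi>: "rat_linear \<phi>" and Q: "lead_coeff Q = 1" "ipoly Q x = 0"
    and B: "x ^ T = 1 + of_int (p\<^sup>2) * ipoly B x"
  shows "scaled_analytic p (\<lambda>n. \<phi> (c * x ^ (r + T * n)))"
proof -
  obtain M :: int where M: "M \<noteq> 0" "\<And>P. of_int M * \<phi> (c * ipoly P x) \<in> \<int>"
    using rat_linear_bounded_denominator[OF \<phi> Q, of c] by blast
  have "\<forall>i. \<exists>z. of_int M * \<phi> (c * ipoly (monom 1 r * B ^ i) x) = of_int z"
    using M(2) by (meson Ints_cases)
  then obtain d where d: "\<And>i. of_int M * \<phi> (c * ipoly (monom 1 r * B ^ i) x) = of_int (d i)" by metis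
  have "of_int M * \<phi> (c * x ^ (r + T * n)) = (\<Sum>i\<le>n. of_nat (n choose i) * of_int (p ^ (2 * i) * d i))" for n
  proof -
    have "x ^ (T * n) = (\<Sum>i\<le>n. of_nat (n choose i) * (of_int (p\<^sup>2) * ipoly B x) ^ i * 1 ^ (n - i))"
      unfolding power_mult B add.commute[of 1] binomial_ring ..
    also have "c * x ^ r * \<dots> = (\<Sum>i\<le>n. of_int (int (n choose i) * p ^ (2 * i)) * (c * ipoly (monom 1 r * B ^ i) x))"
      unfolding sum_distrib_left
      by (intro sum.cong) (simp_all add: ipoly_monom power_mult_distrib algebra_simps flip: power_mult)
    finally have "\<phi> (c * x ^ (r + T * n)) =
       (\<Sum>i\<le>n. of_int (int (n choose i) * p ^ (2 * i)) * \<phi> (c * ipoly (monom 1 r * B ^ i) x))"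
      by (simp add: power_add mult.assoc rat_linear_sum[OF \<phi>] rat_linear_of_int[OF \<phi>] del: of_int_mult of_int_power)
    hence "of_int M * \<phi> (c * x ^ (r + T * n)) =
       (\<Sum>i\<le>n. of_int (int (n choose i) * p ^ (2 * i)) * (of_int M * \<phi> (c * ipoly (monom 1 r * B ^ i) x)))"
      by (simp add: sum_distrib_left mult_ac del: ipoly_mult ipoly_power)
    thus ?thesis unfolding d by (simp add: algebra_simps)
  qed
  hence "padic_analytic p (\<lambda>n. of_int M * \<phi> (c * x ^ (r + T * n)))"
    using padic_analytic_binomial_sum[OF p, of d] by simp
  thus ?thesis unfolding scaled_analytic_def using M by blast
qed

section \<open>Zeros of exponential polynomials on residue classes\<close>

definition exp_poly :: "'a set \<Rightarrow> (nat \<Rightarrow> 'a::field_char_0) \<Rightarrow> bool" where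
  "exp_poly A s \<longleftrightarrow> (\<exists>P. \<forall>n. s n = (\<Sum>\<alpha>\<in>A. poly (P \<alpha>) (of_nat n) * \<alpha> ^ n))"

text \<open>One \<open>T\<close> has to serve all sequences with bases in \<open>A\<close>, since an
  expansion may contain infinitely many of them.\<close>

definition skolem_period :: "'a::field_char_0 set \<Rightarrow> nat \<Rightarrow> bool" where
  "skolem_period A T \<longleftrightarrow> T > 0 \<and>
     (\<forall>s r m. exp_poly A s \<longrightarrow> infinite {m. s (r + T * m) = 0} \<longrightarrow> s (r + T * m) = 0)"

theorem skolem_mahler_lech_uniform:
  fixes A :: "'a::field_char_0 set"
  assumes A: "finite A" "\<And>\<alpha>. \<alpha> \<in> A \<Longrightarrow> algebraic \<alpha>" "0 \<notin> A"
  shows "\<exists>T. skolem_period A T"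
proof -
  have "\<exists>a::int. a \<noteq> 0 \<and> (\<forall>N. a dvd N \<longrightarrow> N \<noteq> 0 \<longrightarrow>
      (\<exists>Q. lead_coeff Q = 1 \<and> coeff Q 0 \<noteq> 0 \<and> ipoly Q (of_int N * \<alpha>) = 0))" if "\<alpha> \<in> A" for \<alpha>
    using algebraic_scaled_monic[of \<alpha>] A that by metis
  then obtain a :: "'a \<Rightarrow> int" where a: "\<And>\<alpha>. \<alpha> \<in> A \<Longrightarrow> a \<alpha> \<noteq> 0"
    "\<And>\<alpha> N. \<alpha> \<in> A \<Longrightarrow> a \<alpha> dvd N \<Longrightarrow> N \<noteq> 0 \<Longrightarrow>
      \<exists>Q. lead_coeff Q = 1 \<and> coeff Q 0 \<noteq> 0 \<and> ipoly Q (of_int N * \<alpha>) = 0"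
    by metis
  define N where "N = prod a A"
  have N: "N \<noteq> 0" using A a by (simp add: N_def)
  have "\<exists>Q. lead_coeff Q = 1 \<and> coeff Q 0 \<noteq> 0 \<and> ipoly Q (of_int N * \<alpha>) = 0" if "\<alpha> \<in> A" for \<alpha>
    using a(2)[OF that _ N] A that unfolding N_def by (metis dvd_prod_eqI)
  then obtain Q where Q: "\<And>\<alpha>. \<alpha> \<in> A \<Longrightarrow> lead_coeff (Q \<alpha>) = 1"
    "\<And>\<alpha>. \<alpha> \<in> A \<Longrightarrow> coeff (Q \<alpha>) 0 \<noteq> 0" "\<And>\<alpha>. \<alpha> \<in> A \<Longrightarrow> ipoly (Q \<alpha>) (of_int N * \<alpha>) = 0" by metis
  \<comment> \<open>A prime larger than the nonzero product of the constant terms is coprime to each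
    of them.\<close>
  obtain q :: nat where q: "prime q" "q > nat \<bar>\<Prod>\<alpha>\<in>A. coeff (Q \<alpha>) 0\<bar>" using bigger_prime by blast
  define p where "p = int q"
  have p: "prime p" using q by (simp add: p_def)
  have "\<bar>\<Prod>\<alpha>\<in>A. coeff (Q \<alpha>) 0\<bar> < p" using q by (simp add: p_def)
  moreover have "(\<Prod>\<alpha>\<in>A. coeff (Q \<alpha>) 0) \<noteq> 0" using A Q by simp
  ultimately have pn: "\<not> p dvd (\<Prod>\<alpha>\<in>A. coeff (Q \<alpha>) 0)" using zdvd_not_zless[of "\<bar>\<Prod>\<alpha>\<in>A. coeff (Q \<alpha>) 0\<bar>" p] by simp
  have cop: "coprime (coeff (Q \<alpha>) 0) (p\<^sup>2)" if "\<alpha> \<in> A" for \<alpha>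
  proof -
    have "\<not> p dvd coeff (Q \<alpha>) 0" using pn A that by (meson dvd_prodI dvd_trans)
    thus ?thesis using p by (simp add: prime_imp_coprime coprime_commute)
  qed
  have "\<exists>T>0. \<exists>B. (of_int N * \<alpha>) ^ T = 1 + of_int (p\<^sup>2) * ipoly B (of_int N * \<alpha>)" if "\<alpha> \<in> A" for \<alpha>
    using p by (intro monic_root_power_cong_1[OF Q(1,3)] that cop) (simp add: prime_gt_0_int)
  then obtain t where t: "\<And>\<alpha>. \<alpha> \<in> A \<Longrightarrow> t \<alpha> > 0"
    "\<And>\<alpha>. \<alpha> \<in> A \<Longrightarrow> \<exists>B. (of_int N * \<alpha>) ^ t \<alpha> = 1 + of_int (p\<^sup>2) * ipoly B (of_int N * \<alpha>)" by metis
  define T where "T = prod t A"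
  have T: "\<exists>B. (of_int N * \<alpha>) ^ T = 1 + of_int (p\<^sup>2) * ipoly B (of_int N * \<alpha>)" if "\<alpha> \<in> A" for \<alpha>
  proof -
    have "t \<alpha> dvd T" using A that unfolding T_def by blast
    then obtain k where "T = t \<alpha> * k" by (elim dvdE)
    thus ?thesis using t(2)[OF that] power_cong_1_mult by blast
  qed
  have "T > 0" using t by (simp add: T_def prod_pos)
  moreover have "s (r + T * m) = 0" if s: "exp_poly A s" and inf: "infinite {m. s (r + T * m) = 0}" for s r m
  proof (rule ccontr)
    assume nz: "s (r + T * m) \<noteq> 0"
    hence "of_int N ^ (r + T * m) * s (r + T * m) \<noteq> 0" using N by simp
    then obtain \<phi> where \<phi>: "rat_linear \<phi>" "\<phi> (of_int N ^ (r + T * m) * s (r + T * m)) \<noteq> 0"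
      using rat_linear_nonzero by blast
    \<comment> \<open>The power of \<open>N\<close> turns every base into the algebraic integer
      \<open>of_int N * \<alpha>\<close>. Zeros of \<open>s\<close> in the class become zeros of
      \<open>b\<close>, and \<phi> is chosen so that \<open>b\<close> does not vanish at the given
      index.\<close>
    define b where "b m = \<phi> (of_int N ^ (r + T * m) * s (r + T * m))" for m
    obtain P where P: "\<And>n. s n = (\<Sum>\<alpha>\<in>A. poly (P \<alpha>) (of_nat n) * \<alpha> ^ n)"
      using s unfolding exp_poly_def by blast
    have b: "b = (\<lambda>m. \<Sum>\<alpha>\<in>A. \<Sum>j\<le>degree (P \<alpha>).
       of_nat (r + T * m) ^ j * \<phi> (coeff (P \<alpha>) j * (of_int N * \<alpha>) ^ (r + T * m)))"
    proof
      fix m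
      have "of_int N ^ (r + T * m) * s (r + T * m) = (\<Sum>\<alpha>\<in>A. \<Sum>j\<le>degree (P \<alpha>).
         of_rat (of_nat (r + T * m) ^ j) * (coeff (P \<alpha>) j * (of_int N * \<alpha>) ^ (r + T * m)))"
        unfolding P poly_altdef sum_distrib_left sum_distrib_right
        by (intro sum.cong) (simp_all add: of_rat_power of_rat_add of_rat_mult power_mult_distrib algebra_simps)
      thus "b m = (\<Sum>\<alpha>\<in>A. \<Sum>j\<le>degree (P \<alpha>).
         of_nat (r + T * m) ^ j * \<phi> (coeff (P \<alpha>) j * (of_int N * \<alpha>) ^ (r + T * m)))"
        unfolding b_def by (simp only: rat_linear_sum[OF \<phi>(1)] rat_linear_scale[OF \<phi>(1)])
    qed
    have "scaled_analytic p b" unfolding b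
    proof (intro scaled_analytic_sum scaled_analytic_mult scaled_analytic_progression_power p)
      fix \<alpha> j assume "\<alpha> \<in> A"
      thus "scaled_analytic p (\<lambda>m. \<phi> (coeff (P \<alpha>) j * (of_int N * \<alpha>) ^ (r + T * m)))"
        using T scaled_analytic_power[OF p \<phi>(1) Q(1) Q(3)] by blast
    qed
    then obtain M :: int where M: "M \<noteq> 0" "padic_analytic p (\<lambda>n. of_int M * b n)"
      unfolding scaled_analytic_def by blast
    have "{m. s (r + T * m) = 0} \<subseteq> {m. of_int M * b m = 0}"
      using rat_linear_0[OF \<phi>(1)] by (auto simp: b_def)
    hence "infinite {m. of_int M * b m = 0}" using inf infinite_super by blast
    hence "of_int M * b m = 0" using padic_analytic_zero[OF p M(2)] by blast
    thus False using \<phi>(2) M(1) by (simp add: b_def)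
  qed
  ultimately show ?thesis unfolding skolem_period_def by blast
qed

section \<open>Linear recursions\<close>

text \<open>This is the polynomial \<open>Q\<close> in the shift operator; it makes sequences a
  module over the polynomial ring.\<close>

definition shift_op :: "'a::field poly \<Rightarrow> (nat \<Rightarrow> 'a) \<Rightarrow> nat \<Rightarrow> 'a" where
  "shift_op Q s n = (\<Sum>j\<le>degree Q. coeff Q j * s (n + j))"

lemma shift_op_0 [simp]: "shift_op 0 s n = 0"
  by (simp add: shift_op_def)

lemma shift_op_pCons [simp]: "shift_op (pCons a Q) s n = a * s n + shift_op Q s (Suc n)"
  by (cases "Q = 0") (simp_all add: shift_op_def sum.atMost_Suc_shift del: sum.atMost_Suc)

lemma shift_op_add: "shift_op (P + Q) s n = shift_op P s n + shift_op Q s n"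
  by (induction P Q arbitrary: n rule: poly_induct2) (simp_all add: algebra_simps)

lemma shift_op_smult: "shift_op (smult a Q) s n = a * shift_op Q s n"
  by (induction Q arbitrary: n) (simp_all add: algebra_simps)

lemma shift_op_mult: "shift_op (P * Q) s n = shift_op P (shift_op Q s) n"
  by (induction P arbitrary: n) (simp_all add: shift_op_add shift_op_smult)

lemma shift_op_add_right: "shift_op Q (\<lambda>n. s n + t n) n = shift_op Q s n + shift_op Q t n"
  by (simp add: shift_op_def algebra_simps sum.distrib)

lemma shift_op_monom: "shift_op (monom a k) s n = a * s (n + k)"
  by (induction k arbitrary: n) (simp_all add: monom_0 monom_Suc)

text \<open>In this form sums are handled by multiplying annihilators; the leading coefficient is
  normalised only when the recursion is extracted.\<close>

definition annihilated :: "(nat \<Rightarrow> 'a::field) \<Rightarrow> bool" where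
  "annihilated s \<longleftrightarrow> (\<exists>Q. Q \<noteq> 0 \<and> eventually (\<lambda>n. shift_op Q s n = 0) sequentially)"

lemma shift_op_eventually_0:
  assumes "eventually (\<lambda>n. s n = 0) sequentially"
  shows "eventually (\<lambda>n. shift_op Q s n = 0) sequentially"
proof -
  obtain N where "\<And>n. n \<ge> N \<Longrightarrow> s n = 0" using assms unfolding eventually_sequentially by blast
  thus ?thesis unfolding eventually_sequentially shift_op_def by (intro exI[of _ N]) auto
qed

lemma annihilated_eventually_0: "eventually (\<lambda>n. s n = 0) sequentially \<Longrightarrow> annihilated s"
  unfolding annihilated_def by (intro exI[of _ 1]) (simp add: one_pCons)

lemma annihilated_shift_op: "Q \<noteq> 0 \<Longrightarrow> annihilated (shift_op Q s) \<Longrightarrow> annihilated s"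
  unfolding annihilated_def shift_op_mult[symmetric] by (meson mult_eq_0_iff)

lemma annihilated_add:
  assumes "annihilated s" "annihilated t"
  shows "annihilated (\<lambda>n. s n + t n)"
proof -
  obtain P Q where P: "P \<noteq> 0" "eventually (\<lambda>n. shift_op P s n = 0) sequentially"
    and Q: "Q \<noteq> 0" "eventually (\<lambda>n. shift_op Q t n = 0) sequentially"
    using assms unfolding annihilated_def by blast
  have "eventually (\<lambda>n. shift_op (P * Q) (\<lambda>n. s n + t n) n = 0) sequentially"
    using shift_op_eventually_0[OF P(2), of Q] shift_op_eventually_0[OF Q(2), of P]
  proof eventually_elim
    case (elim n)
    have "shift_op (P * Q) s n = 0" using elim(1) unfolding shift_op_mult[symmetric] by (simp add: mult.commute)
    moreover have "shift_op (P * Q) t n = 0" using elim(2) unfolding shift_op_mult[symmetric] .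
    ultimately show ?case by (simp add: shift_op_add_right)
  qed
  thus ?thesis using P(1) Q(1) unfolding annihilated_def by (intro exI[of _ "P * Q"]) auto
qed

lemma annihilated_sum: "(\<And>i. i \<in> I \<Longrightarrow> annihilated (f i)) \<Longrightarrow> annihilated (\<lambda>n. \<Sum>i\<in>I. f i n)"
proof (induction I rule: infinite_finite_induct)
  case (insert x F)
  thus ?case using annihilated_add[of "f x" "\<lambda>n. \<Sum>i\<in>F. f i n"] by simp
qed (auto intro: annihilated_eventually_0)

lemma annihilated_cong:
  assumes "eventually (\<lambda>n. s n = t n) sequentially" "annihilated t"
  shows "annihilated s"
proof -
  have "eventually (\<lambda>n. s n - t n = 0) sequentially" using assms(1) by simp
  hence "annihilated (\<lambda>n. s n - t n)" by (rule annihilated_eventually_0)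
  from annihilated_add[OF this assms(2)] show ?thesis by simp
qed

text \<open>The operator \<open>X ^ T - \<alpha> ^ T\<close> keeps the periodic factor and replaces
  \<open>n ^ j\<close> by a multiple of \<open>(n + T) ^ j - n ^ j\<close>, which involves only
  powers of \<open>n\<close> below \<open>j\<close>. Induction on \<open>j\<close> treats
  these.\<close>

lemma annihilated_periodic_exp:
  fixes c :: "nat \<Rightarrow> 'a::field"
  assumes "T > 0" and "\<And>n. c (n + T) = c n"
  shows "annihilated (\<lambda>n. c n * of_nat n ^ j * \<alpha> ^ n)"
  using assms(2)
proof (induction j arbitrary: c rule: less_induct)
  case (less j)
  let ?s = "\<lambda>n. c n * of_nat n ^ j * \<alpha> ^ n"
  define Q where "Q = monom 1 T - [:\<alpha> ^ T:]"
  have "coeff Q T = 1" using assms(1) by (simp add: Q_def coeff_pCons split: nat.splits)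
  hence "Q \<noteq> 0" by auto
  define f where "f i n = (\<alpha> ^ T * of_nat (j choose i) * of_nat T ^ (j - i) * c n) * of_nat n ^ i * \<alpha> ^ n" for i n
  have "shift_op Q ?s n = (\<Sum>i<j. f i n)" for n
  proof -
    have "Q = monom 1 T + [:- (\<alpha> ^ T):]" by (simp add: Q_def)
    hence "shift_op Q ?s n = ?s (n + T) - \<alpha> ^ T * ?s n"
      by (simp only: shift_op_add shift_op_monom) simp
    also have "c (n + T) = c n" by (rule less.prems)
    also have "c n * of_nat (n + T) ^ j * \<alpha> ^ (n + T) - \<alpha> ^ T * (c n * of_nat n ^ j * \<alpha> ^ n) =
        \<alpha> ^ T * c n * \<alpha> ^ n * ((of_nat n + of_nat T) ^ j - of_nat n ^ j)"
      by (simp add: power_add algebra_simps)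
    also have "(of_nat n + of_nat T) ^ j - of_nat n ^ j =
        (\<Sum>i<j. of_nat (j choose i) * of_nat n ^ i * of_nat T ^ (j - i) :: 'a)"
      unfolding binomial_ring by (simp add: lessThan_Suc_atMost[symmetric])
    finally show ?thesis by (simp add: f_def sum_distrib_left algebra_simps)
  qed
  hence "shift_op Q ?s = (\<lambda>n. \<Sum>i<j. f i n)" by (rule ext)
  moreover have "annihilated (\<lambda>n. \<Sum>i<j. f i n)"
    unfolding f_def using less by (intro annihilated_sum less.IH) auto
  ultimately show ?case using annihilated_shift_op[OF \<open>Q \<noteq> 0\<close>] by metis
qed

lemma annihilated_imp_eventually_linear_recursive:
  assumes "annihilated s" shows "eventually_linear_recursive s"
proof -
  obtain Q where Q: "Q \<noteq> 0" "eventually (\<lambda>n. shift_op Q s n = 0) sequentially"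
    using assms unfolding annihilated_def by blast
  have "eventually (\<lambda>n. s (n + degree Q) = (\<Sum>j<degree Q. - coeff Q j / lead_coeff Q * s (n + j))) sequentially"
    using Q(2)
  proof eventually_elim
    case (elim n)
    have "(\<Sum>j<degree Q. coeff Q j * s (n + j)) + lead_coeff Q * s (n + degree Q) = 0"
      using elim by (simp add: shift_op_def lessThan_Suc_atMost[symmetric])
    hence "lead_coeff Q * s (n + degree Q) = - (\<Sum>j<degree Q. coeff Q j * s (n + j))"
      by (simp add: eq_neg_iff_add_eq_0 add.commute)
    hence "s (n + degree Q) = - (\<Sum>j<degree Q. coeff Q j * s (n + j)) / lead_coeff Q"
      using Q(1) by (simp add: field_simps)
    thus ?case by (simp add: sum_negf sum_divide_distrib)
  qed
  thus ?thesis unfolding eventually_linear_recursive_def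
    by (intro exI[of _ "degree Q"] exI[of _ "\<lambda>j. - coeff Q j / lead_coeff Q"])
qed

text \<open>The indicator of a residue class has period \<open>T\<close>, so the glued sequence is
  eventually a sum of periodic multiples of \<open>n ^ j * \<alpha> ^ n\<close>.\<close>

lemma piecewise_exp_poly_linear_recursive:
  assumes T: "T > 0" and t: "\<And>r. r < T \<Longrightarrow> exp_poly A (t r)"
    and s: "\<And>r. r < T \<Longrightarrow> eventually (\<lambda>n. n mod T = r \<longrightarrow> s n = t r n) sequentially"
  shows "eventually_linear_recursive s"
proof -
  obtain P where P: "\<And>r n. r < T \<Longrightarrow> t r n = (\<Sum>\<alpha>\<in>A. poly (P r \<alpha>) (of_nat n) * \<alpha> ^ n)"
    using t unfolding exp_poly_def by metis
  define u where "u r n = (\<Sum>\<alpha>\<in>A. \<Sum>j\<le>degree (P r \<alpha>).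
      (if n mod T = r then coeff (P r \<alpha>) j else 0) * of_nat n ^ j * \<alpha> ^ n)" for r n
  have u: "u r n = (if n mod T = r then t r n else 0)" if "r < T" for r n
    using P[OF that] by (simp add: u_def poly_altdef sum_distrib_right)
  have "annihilated (\<lambda>n. \<Sum>r<T. u r n)" unfolding u_def
    by (intro annihilated_sum annihilated_periodic_exp[OF T]) simp
  moreover have "eventually (\<lambda>n. \<forall>r<T. n mod T = r \<longrightarrow> s n = t r n) sequentially"
    using s eventually_ball_finite[of "{..<T}" "\<lambda>n r. n mod T = r \<longrightarrow> s n = t r n" sequentially] by simp
  hence "eventually (\<lambda>n. s n = (\<Sum>r<T. u r n)) sequentially"
  proof eventually_elim
    case (elim n)
    have "(\<Sum>r<T. u r n) = (\<Sum>r<T. if n mod T = r then t r n else 0)"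
      by (intro sum.cong) (simp_all add: u)
    thus ?case using elim T by simp
  qed
  ultimately have "annihilated s" by (rule annihilated_cong[rotated])
  thus ?thesis by (rule annihilated_imp_eventually_linear_recursive)
qed

lemma piecewise_quadratic_quasi_polynomial:
  assumes T: "T > 0"
  shows "quadratic_quasi_polynomial (\<lambda>n. a (n mod T) * of_nat n ^ 2 + b (n mod T) * of_nat n + e (n mod T))"
proof -
  define c where "c j n = (if j = 0 then e (n mod T) else if j = 1 then b (n mod T)
    else if j = 2 then a (n mod T) else 0)" for j n :: nat
  have "periodic (c j)" for j
    unfolding periodic_def c_def using T by (intro exI[of _ T]) simp
  thus ?thesis unfolding quadratic_quasi_polynomial_def
    by (intro exI[of _ 2] exI[of _ c]) (auto simp: c_def numeral_2_eq_2)
qed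

section \<open>Exponential polynomials and Puiseux series\<close>

lemma exp_poly_0: "exp_poly A (\<lambda>_. 0)"
  unfolding exp_poly_def by (intro exI[of _ "\<lambda>_. 0"]) simp

lemma exp_poly_add:
  assumes "exp_poly A s" "exp_poly A t" shows "exp_poly A (\<lambda>n. s n + t n)"
proof -
  obtain P Q where "\<forall>n. s n = (\<Sum>\<alpha>\<in>A. poly (P \<alpha>) (of_nat n) * \<alpha> ^ n)"
    "\<forall>n. t n = (\<Sum>\<alpha>\<in>A. poly (Q \<alpha>) (of_nat n) * \<alpha> ^ n)" using assms unfolding exp_poly_def by blast
  thus ?thesis unfolding exp_poly_def
    by (intro exI[of _ "\<lambda>\<alpha>. P \<alpha> + Q \<alpha>"]) (simp add: algebra_simps sum.distrib)
qed

lemma exp_poly_sum: "(\<And>i. i \<in> I \<Longrightarrow> exp_poly A (f i)) \<Longrightarrow> exp_poly A (\<lambda>n. \<Sum>i\<in>I. f i n)"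
proof (induction I rule: infinite_finite_induct)
  case (insert x F)
  thus ?case using exp_poly_add[of A "f x" "\<lambda>n. \<Sum>i\<in>F. f i n"] by simp
qed (simp_all add: exp_poly_0)

lemma exp_poly_poly_mult:
  assumes "exp_poly A s" shows "exp_poly A (\<lambda>n. poly Q (of_nat n) * s n)"
proof -
  obtain P where "\<forall>n. s n = (\<Sum>\<alpha>\<in>A. poly (P \<alpha>) (of_nat n) * \<alpha> ^ n)"
    using assms unfolding exp_poly_def by blast
  thus ?thesis unfolding exp_poly_def
    by (intro exI[of _ "\<lambda>\<alpha>. Q * P \<alpha>"]) (simp add: sum_distrib_left algebra_simps)
qed

lemma exp_poly_mono:
  assumes "exp_poly A s" "A \<subseteq> B" "finite B" shows "exp_poly B s"
proof -
  obtain P where P: "\<forall>n. s n = (\<Sum>\<alpha>\<in>A. poly (P \<alpha>) (of_nat n) * \<alpha> ^ n)"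
    using assms unfolding exp_poly_def by blast
  have "(\<Sum>\<alpha>\<in>B. poly (if \<alpha> \<in> A then P \<alpha> else 0) (of_nat n) * \<alpha> ^ n) =
        (\<Sum>\<alpha>\<in>A. poly (P \<alpha>) (of_nat n) * \<alpha> ^ n)" for n
    using assms by (intro sum.mono_neutral_cong_right) auto
  thus ?thesis using P unfolding exp_poly_def
    by (intro exI[of _ "\<lambda>\<alpha>. if \<alpha> \<in> A then P \<alpha> else 0"]) simp
qed

lemma exp_poly_power: "exp_poly {\<alpha>} (\<lambda>n. \<alpha> ^ n)"
  unfolding exp_poly_def by (intro exI[of _ "\<lambda>_. 1"]) simp

text \<open>Unlike an inequality for \<open>puiseux_deg\<close>, this covers the zero series and
  passes to sums without case distinctions.\<close>

definition supp_ge :: "rat \<Rightarrow> 'a::zero puiseux \<Rightarrow> bool" where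
  "supp_ge a f \<longleftrightarrow> (\<forall>x. puiseux_nth f x \<noteq> 0 \<longrightarrow> a \<le> x)"

definition supp_lattice :: "nat \<Rightarrow> 'a::zero puiseux \<Rightarrow> bool" where
  "supp_lattice R f \<longleftrightarrow> (\<forall>x. puiseux_nth f x \<noteq> 0 \<longrightarrow> of_nat R * x \<in> \<int>)"

lemma supp_geD: "supp_ge a f \<Longrightarrow> puiseux_nth f x \<noteq> 0 \<Longrightarrow> a \<le> x"
  and supp_latticeD: "supp_lattice R f \<Longrightarrow> puiseux_nth f x \<noteq> 0 \<Longrightarrow> of_nat R * x \<in> \<int>"
  by (simp_all add: supp_ge_def supp_lattice_def)

lemma supp_ge_eq_0: "supp_ge a f \<Longrightarrow> x < a \<Longrightarrow> puiseux_nth f x = 0"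
  by (meson supp_geD leD)

lemma puiseux_nth_timesE:
  assumes "puiseux_nth (f * g :: 'a::field puiseux) x \<noteq> 0"
  obtains y where "puiseux_nth f y \<noteq> 0" "puiseux_nth g (x - y) \<noteq> 0"
  using sum.not_neutral_contains_not_neutral[OF assms[unfolded puiseux_nth_times]] that by auto

lemma supp_ge_times: "supp_ge a f \<Longrightarrow> supp_ge b g \<Longrightarrow> supp_ge (a + b) (f * g :: 'a::field puiseux)"
  unfolding supp_ge_def by (smt (verit) puiseux_nth_timesE add_mono diff_add_cancel add.commute)

lemma supp_lattice_times:
  assumes "supp_lattice R f" "supp_lattice R g" shows "supp_lattice R (f * g :: 'a::field puiseux)"
  unfolding supp_lattice_def
proof (intro allI impI)
  fix x assume "puiseux_nth (f * g) x \<noteq> 0"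
  then obtain y where "puiseux_nth f y \<noteq> 0" "puiseux_nth g (x - y) \<noteq> 0" by (rule puiseux_nth_timesE)
  hence "of_nat R * y + of_nat R * (x - y) \<in> \<int>" using assms by (intro Ints_add) (auto dest: supp_latticeD)
  thus "of_nat R * x \<in> \<int>" by (simp add: algebra_simps)
qed

lemma supp_ge_sum: "(\<And>i. i \<in> I \<Longrightarrow> supp_ge a (f i)) \<Longrightarrow> supp_ge a (\<Sum>i\<in>I. f i :: 'a::field puiseux)"
  unfolding supp_ge_def puiseux_nth_sum by (auto elim!: sum.not_neutral_contains_not_neutral)

lemma supp_lattice_sum:
  "(\<And>i. i \<in> I \<Longrightarrow> supp_lattice R (f i)) \<Longrightarrow> supp_lattice R (\<Sum>i\<in>I. f i :: 'a::field puiseux)"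
  unfolding supp_lattice_def puiseux_nth_sum by (auto elim!: sum.not_neutral_contains_not_neutral)

lemma supp_ge_power: "supp_ge a f \<Longrightarrow> supp_ge (of_nat n * a) (f ^ n :: 'a::field puiseux)"
proof (induction n)
  case (Suc n)
  thus ?case using supp_ge_times[of a f "of_nat n * a" "f ^ n"] by (simp add: algebra_simps)
qed (simp add: supp_ge_def puiseux_nth_1)

lemma supp_lattice_power: "supp_lattice R f \<Longrightarrow> supp_lattice R (f ^ n :: 'a::field puiseux)"
proof (induction n)
  case (Suc n)
  thus ?case by (simp add: supp_lattice_times)
qed (simp add: supp_lattice_def puiseux_nth_1)

lemma supp_lattice_mono: "supp_lattice R f \<Longrightarrow> R dvd S \<Longrightarrow> supp_lattice S f"
  unfolding supp_lattice_def by (auto elim!: dvdE simp: mult.assoc mult.left_commute[of "of_nat R"])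

lemma supp_of_nat:
  "supp_ge 0 (of_nat m :: 'a::field puiseux)" "supp_lattice R (of_nat m :: 'a::field puiseux)"
  using puiseux_nth_times_of_nat[of "1 :: 'a puiseux" m]
  by (auto simp: supp_ge_def supp_lattice_def puiseux_nth_1 split: if_splits)

lemma supp_lattice_laurent_root: "f \<in> laurent_root r \<Longrightarrow> r \<ge> 1 \<Longrightarrow> supp_lattice r f"
  unfolding supp_lattice_def by (simp add: laurent_root_iff) blast

lemma supp_lattice_exists: "\<exists>R\<ge>1. supp_lattice R f"
  using puiseux_in_laurent_root[of f] supp_lattice_laurent_root by blast

lemma supp_ge_deg: "supp_ge (puiseux_deg f) (f :: 'a::field puiseux)"
proof (cases "f = 0")
  case False
  thus ?thesis unfolding supp_ge_def using puiseux_deg_le by blast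
qed (simp add: supp_ge_def)

section \<open>Powers of q and coefficients of powers of a series\<close>

lemma puiseux_nth_minus [simp]:
  "puiseux_nth (f - g :: 'a::field puiseux) x = puiseux_nth f x - puiseux_nth g x"
  using puiseux_nth_add[of "f - g" g x] by (simp add: eq_diff_eq)

lemma q_powr_add: "q_powr a * q_powr b = (q_powr (a + b) :: 'a::field puiseux)"
  by (rule puiseux_eqI) (auto simp: puiseux_nth_times_q_powr puiseux_nth_q_powr algebra_simps)

lemma q_powr_0: "q_powr 0 = (1 :: 'a::field puiseux)"
  by (rule puiseux_eqI) (simp add: puiseux_nth_q_powr puiseux_nth_1)

lemma q_powr_power: "q_powr a ^ n = (q_powr (of_nat n * a) :: 'a::field puiseux)"
  by (induction n) (simp_all add: q_powr_0 q_powr_add algebra_simps)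

definition puiseux_const :: "'a::field \<Rightarrow> 'a puiseux" where
  "puiseux_const a = puiseux_of_fls 1 (fls_const a)"

lemma puiseux_nth_const: "puiseux_nth (puiseux_const a) x = (if x = 0 then a else 0)"
  by (auto simp: puiseux_const_def puiseux_nth_of_fls ramify_def elim!: Ints_cases)

lemma puiseux_nth_times_const: "puiseux_nth (f * puiseux_const a) x = puiseux_nth f x * a"
proof -
  have "{y. puiseux_nth f y \<noteq> 0 \<and> puiseux_nth (puiseux_const a) (x - y) \<noteq> 0} =
      (if puiseux_nth f x = 0 \<or> a = 0 then {} else {x})"
    by (auto simp: puiseux_nth_const)
  thus ?thesis unfolding puiseux_nth_times by (auto simp: puiseux_nth_const)
qed

lemma puiseux_const_power: "puiseux_const a ^ n = puiseux_const (a ^ n)"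
proof (induction n)
  case 0
  show ?case by (rule puiseux_eqI) (simp add: puiseux_nth_const puiseux_nth_1)
next
  case (Suc n)
  show ?case unfolding power_Suc Suc
    by (rule puiseux_eqI) (simp add: puiseux_nth_times_const puiseux_nth_const)
qed

text \<open>Write \<nu> as its constant term \<alpha> plus \<kappa>, whose exponents are at least
  \<open>1 / R\<close>. In the binomial expansion only the powers \<open>\<kappa> ^ l\<close> up to
  a bound independent of \<open>n\<close> reach \<open>x\<close>; each contributes
  \<open>n choose l\<close> times \<open>\<alpha> ^ n\<close> up to a constant.\<close>

lemma exp_poly_nth_power:
  fixes \<nu> g :: "'a::field_char_0 puiseux"
  assumes R: "R \<ge> 1" and \<nu>: "supp_lattice R \<nu>" "supp_ge 0 \<nu>" and nz: "puiseux_nth \<nu> 0 \<noteq> 0"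
  shows "exp_poly {puiseux_nth \<nu> 0} (\<lambda>n. puiseux_nth (g * \<nu> ^ n) x)"
proof -
  define \<alpha> where "\<alpha> = puiseux_nth \<nu> 0"
  define \<kappa> where "\<kappa> = \<nu> - puiseux_const \<alpha>"
  have "supp_ge (1 / of_nat R) \<kappa>"
    unfolding supp_ge_def
  proof (intro allI impI)
    fix y assume y: "puiseux_nth \<kappa> y \<noteq> 0"
    have "y \<noteq> 0" using y by (auto simp: \<kappa>_def puiseux_nth_const \<alpha>_def)
    hence "puiseux_nth \<nu> y \<noteq> 0" using y by (simp add: \<kappa>_def puiseux_nth_const)
    hence "of_nat R * y \<in> \<int>" "0 \<le> y" using \<nu> supp_latticeD supp_geD by blast+
    then obtain i where i: "of_nat R * y = of_int i" by (auto elim: Ints_cases)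
    have "of_nat R * y > 0" using R \<open>0 \<le> y\<close> \<open>y \<noteq> 0\<close> by simp
    hence "i \<ge> 1" unfolding i by simp
    hence "of_nat R * y \<ge> 1" unfolding i by simp
    thus "1 / of_nat R \<le> y" using R by (simp add: field_simps)
  qed
  hence supp: "supp_ge (puiseux_deg g + of_nat l * (1 / of_nat R)) (g * \<kappa> ^ l)" for l
    by (intro supp_ge_times supp_ge_deg supp_ge_power)
  \<comment> \<open>For \<open>l > L\<close> the factor \<open>\<kappa> ^ l\<close> pushes the
    support of the product beyond \<open>x\<close>.\<close>
  define L where "L = nat \<lceil>of_nat R * (x - puiseux_deg g)\<rceil>"
  define w where "w l = puiseux_nth (g * \<kappa> ^ l) x" for l
  have w: "w l = 0" if "l > L" for l
  proof -
    have "of_int \<lceil>of_nat R * (x - puiseux_deg g)\<rceil> < (of_int (int l) :: rat)"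
      using that unfolding L_def of_int_less_iff by linarith
    hence "of_nat R * (x - puiseux_deg g) < of_nat l" by linarith
    hence "x - puiseux_deg g < of_nat l / of_nat R"
      using R by (subst pos_less_divide_eq) (simp_all add: mult.commute)
    hence "x < puiseux_deg g + of_nat l * (1 / of_nat R)" by simp
    thus ?thesis unfolding w_def by (rule supp_ge_eq_0[OF supp])
  qed
  define Q where "Q = (\<Sum>l\<le>L. smult (w l / \<alpha> ^ l) (binomial_poly l))"
  have "puiseux_nth (g * \<nu> ^ n) x = poly Q (of_nat n) * \<alpha> ^ n" for n
  proof -
    have \<nu>_eq: "\<nu> = \<kappa> + puiseux_const \<alpha>" by (simp add: \<kappa>_def)
    have "g * \<nu> ^ n = (\<Sum>l\<le>n. (g * \<kappa> ^ l * puiseux_const (\<alpha> ^ (n - l))) * of_nat (n choose l))"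
      unfolding \<nu>_eq binomial_ring sum_distrib_left puiseux_const_power
      by (intro sum.cong) (simp_all only: mult_ac)
    hence "puiseux_nth (g * \<nu> ^ n) x = (\<Sum>l\<le>n. w l * \<alpha> ^ (n - l) * of_nat (n choose l))"
      by (simp add: puiseux_nth_sum puiseux_nth_times_of_nat puiseux_nth_times_const w_def)
    also have "\<dots> = (\<Sum>l\<le>n. w l / \<alpha> ^ l * of_nat (n choose l) * \<alpha> ^ n)"
      using nz by (intro sum.cong) (simp_all add: \<alpha>_def power_diff)
    \<comment> \<open>The range is enlarged first, as \<open>n choose l\<close> vanishes for
      \<open>l > n\<close>, and then cut to \<open>L\<close>, where it no longer depends on
      \<open>n\<close>.\<close>
    also have "\<dots> = (\<Sum>l\<le>max n L. w l / \<alpha> ^ l * of_nat (n choose l) * \<alpha> ^ n)"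
      by (intro sum.mono_neutral_left) auto
    also have "\<dots> = (\<Sum>l\<le>L. w l / \<alpha> ^ l * of_nat (n choose l) * \<alpha> ^ n)"
      using w by (intro sum.mono_neutral_right) auto
    finally show ?thesis
      by (simp add: Q_def poly_sum poly_binomial_poly sum_distrib_right)
  qed
  thus ?thesis using exp_poly_poly_mult[OF exp_poly_power[of \<alpha>], of Q] by (simp add: \<alpha>_def)
qed

section \<open>Expansions of formal WKB series\<close>

text \<open>Every slope that contributes to the exponent \<open>\<gamma> * n ^ 2 + z\<close> lies in
  this set, which depends only on the bounds and not on \<open>U\<close>.\<close>

definition expansion_slopes :: "nat \<Rightarrow> rat \<Rightarrow> nat \<Rightarrow> rat \<Rightarrow> rat set" where
  "expansion_slopes R C n z = {b. of_nat R * b \<in> \<int> \<and> - C \<le> b \<and> - C * (b + C + 1) \<le> z - b * of_nat n}"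

text \<open>
  \<open>U n b x\<close> is the contribution of the pair \<open>(b, x)\<close> to the coefficient of \<open>q\<^bsup>\<gamma> n\<^sup>2 + b n + x\<^esup>\<close>; different
  pairs may yield the same exponent. The lower bound for \<open>x\<close> in terms of \<open>b\<close> reflects the condition
  \<open>\<delta>(\<phi>\<^bsub>i,k\<^esub>) \<ge> c k\<close> on the amplitude, and makes the sum over \<open>b\<close> finite as soon as \<open>n > C\<close>.
\<close>

definition double_expansion ::
  "nat \<Rightarrow> rat \<Rightarrow> 'a set \<Rightarrow> rat \<Rightarrow> (nat \<Rightarrow> rat \<Rightarrow> rat \<Rightarrow> 'a) \<Rightarrow> (nat \<Rightarrow> 'a::field_char_0 puiseux) \<Rightarrow> bool" where
  "double_expansion R C A \<gamma> U g \<longleftrightarrow>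
     (\<forall>n b x. U n b x \<noteq> 0 \<longrightarrow> of_nat R * b \<in> \<int> \<and> of_nat R * x \<in> \<int> \<and> - C \<le> b \<and> - C * (b + C + 1) \<le> x) \<and>
     (\<forall>b x. exp_poly A (\<lambda>n. U n b x)) \<and>
     (\<forall>n z. of_nat n > C \<longrightarrow>
        puiseux_nth (g n) (\<gamma> * of_nat n ^ 2 + z) =
          (\<Sum>b\<in>expansion_slopes R C n z. U n b (z - b * of_nat n)))"

section \<open>Finiteness and change of parameters\<close>

lemma finite_lattice_interval:
  assumes "R \<ge> 1"
  shows "finite {b::rat. of_nat R * b \<in> \<int> \<and> l \<le> b \<and> b \<le> u}"
proof (rule finite_subset)
  show "{b::rat. of_nat R * b \<in> \<int> \<and> l \<le> b \<and> b \<le> u} \<subseteq>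
    (\<lambda>i. of_int i / of_nat R) ` {\<lceil>of_nat R * l\<rceil>..\<lfloor>of_nat R * u\<rfloor>}"
  proof
    fix b :: rat assume "b \<in> {b. of_nat R * b \<in> \<int> \<and> l \<le> b \<and> b \<le> u}"
    hence b: "of_nat R * b \<in> \<int>" "l \<le> b" "b \<le> u" by auto
    then obtain i where i: "of_nat R * b = of_int i" by (auto elim: Ints_cases)
    have "of_nat R * l \<le> of_int i" "of_int i \<le> of_nat R * u"
      unfolding i[symmetric] using b by (simp_all add: mult_left_mono)
    moreover have "b = of_int i / of_nat R" using i assms by (simp add: field_simps)
    ultimately show "b \<in> (\<lambda>i. of_int i / of_nat R) ` {\<lceil>of_nat R * l\<rceil>..\<lfloor>of_nat R * u\<rfloor>}"
      by (auto simp: le_floor_iff ceiling_le_iff)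
  qed
qed simp

text \<open>The bound on \<open>z - b * n\<close> rearranges to
  \<open>b * (n - C) \<le> z + C * (C + 1)\<close>, so \<open>n > C\<close> bounds the slopes
  above.\<close>

lemma finite_expansion_slopes:
  assumes "R \<ge> 1" "of_nat n > C"
  shows "finite (expansion_slopes R C n z)"
proof (rule finite_subset)
  show "expansion_slopes R C n z \<subseteq>
    {b. of_nat R * b \<in> \<int> \<and> - C \<le> b \<and> b \<le> (z + C * (C + 1)) / (of_nat n - C)}"
    using assms by (auto simp: expansion_slopes_def pos_le_divide_eq algebra_simps)
qed (rule finite_lattice_interval[OF assms(1)])

lemma double_expansionD:
  assumes "double_expansion R C A \<gamma> U g"
  shows "U n b x \<noteq> 0 \<Longrightarrow> of_nat R * b \<in> \<int>" "U n b x \<noteq> 0 \<Longrightarrow> of_nat R * x \<in> \<int>"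
    "U n b x \<noteq> 0 \<Longrightarrow> - C \<le> b" "U n b x \<noteq> 0 \<Longrightarrow> - C * (b + C + 1) \<le> x"
    "exp_poly A (\<lambda>n. U n b x)"
    "of_nat n > C \<Longrightarrow> puiseux_nth (g n) (\<gamma> * of_nat n ^ 2 + z) =
          (\<Sum>b\<in>expansion_slopes R C n z. U n b (z - b * of_nat n))"
  using assms unfolding double_expansion_def by blast+

text \<open>This brings different series to common parameters. Both slope sets contain all nonzero
  contributions, so the sums agree.\<close>

lemma double_expansion_mono:
  assumes exp: "double_expansion R C A \<gamma> U g"
    and R: "R dvd R'" "R' \<ge> 1" and C: "0 \<le> C" "C \<le> C'" and A: "A \<subseteq> A'" "finite A'"
  shows "double_expansion R' C' A' \<gamma> U g"
  unfolding double_expansion_def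
proof (intro conjI allI impI)
  fix n b x
  show "exp_poly A' (\<lambda>n. U n b x)" using double_expansionD(5)[OF exp] A by (rule exp_poly_mono)
  assume "U n b x \<noteq> 0"
  note U = double_expansionD(1-4)[OF exp this]
  obtain k where k: "R' = R * k" using R by (elim dvdE)
  show "of_nat R' * b \<in> \<int>" "of_nat R' * x \<in> \<int>"
    using Ints_mult[OF Ints_of_nat[of k] U(1)] Ints_mult[OF Ints_of_nat[of k] U(2)]
    by (simp_all add: k algebra_simps)
  show "- C' \<le> b" using U(3) C by linarith
  have "C * (b + C + 1) \<le> C' * (b + C' + 1)" using U(3) C by (intro mult_mono) auto
  thus "- C' * (b + C' + 1) \<le> x" using U(4) by simp
next
  have R1: "R \<ge> 1" using R by (metis dvd_0_left_iff less_one not_le)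
  fix n z assume n: "of_nat n > C'"
  hence nC: "of_nat n > C" using C by linarith
  have "b \<in> expansion_slopes R' C' n z" if "U n b (z - b * of_nat n) \<noteq> 0" for b
  proof -
    note U = double_expansionD(1-4)[OF exp that]
    obtain k where k: "R' = R * k" using R by (elim dvdE)
    have "of_nat R' * b \<in> \<int>"
      using Ints_mult[OF Ints_of_nat[of k] U(1)] by (simp add: k algebra_simps)
    moreover have "C * (b + C + 1) \<le> C' * (b + C' + 1)" using U(3) C by (intro mult_mono) auto
    ultimately show ?thesis using U(3,4) C by (auto simp: expansion_slopes_def)
  qed
  moreover have "b \<in> expansion_slopes R C n z" if "U n b (z - b * of_nat n) \<noteq> 0" for b
    using double_expansionD(1-4)[OF exp that] by (auto simp: expansion_slopes_def)
  ultimately have "(\<Sum>b\<in>expansion_slopes R C n z. U n b (z - b * of_nat n)) =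
     (\<Sum>b\<in>expansion_slopes R' C' n z. U n b (z - b * of_nat n))"
    using finite_expansion_slopes[OF R1 nC] finite_expansion_slopes[OF R(2) n]
    by (intro sum.mono_neutral_cong) auto
  thus "puiseux_nth (g n) (\<gamma> * of_nat n ^ 2 + z) =
          (\<Sum>b\<in>expansion_slopes R' C' n z. U n b (z - b * of_nat n))"
    using double_expansionD(6)[OF exp nC] by simp
qed

lemma double_expansion_sum:
  assumes "\<And>i. i \<in> I \<Longrightarrow> double_expansion R C A \<gamma> (U i) (g i)"
  shows "double_expansion R C A \<gamma> (\<lambda>n b x. \<Sum>i\<in>I. U i n b x) (\<lambda>n. \<Sum>i\<in>I. g i n)"
  unfolding double_expansion_def
proof (intro conjI allI impI)
  fix n b x
  show "exp_poly A (\<lambda>n. \<Sum>i\<in>I. U i n b x)"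
    using double_expansionD(5)[OF assms] by (intro exp_poly_sum) auto
  assume "(\<Sum>i\<in>I. U i n b x) \<noteq> 0"
  then obtain i where "i \<in> I" "U i n b x \<noteq> 0" by (rule sum.not_neutral_contains_not_neutral)
  thus "of_nat R * b \<in> \<int>" "of_nat R * x \<in> \<int>" "- C \<le> b" "- C * (b + C + 1) \<le> x"
    using double_expansionD(1-4)[OF assms] by blast+
next
  fix n z assume "of_nat n > C"
  thus "puiseux_nth (\<Sum>i\<in>I. g i n) (\<gamma> * of_nat n ^ 2 + z) =
    (\<Sum>b\<in>expansion_slopes R C n z. \<Sum>i\<in>I. U i n b (z - b * of_nat n))"
    unfolding puiseux_nth_sum sum.swap[of _ I]
    by (intro sum.cong refl double_expansionD(6)[OF assms])
qed

section \<open>Expansion of one WKB series\<close>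

lemma add_divide_pos_rat:
  fixes c :: rat
  assumes "r \<ge> 1" "of_nat n > - of_nat r * c"
  shows "c + of_nat n / of_nat r > 0"
proof -
  have "- c < of_nat n / of_nat r"
    using assms by (subst pos_less_divide_eq) (simp_all add: mult.commute)
  thus ?thesis by linarith
qed

text \<open>Term \<open>k\<close> starts no earlier than \<open>d * k\<close>, where
  \<open>d = c + n / r\<close> is positive; coefficients below \<open>d * k0\<close> therefore come
  from the first \<open>k0\<close> terms.\<close>

lemma wkb_amp_eval_truncation:
  fixes n k0 :: nat and \<tau> :: wkb
  assumes \<tau>: "formal_wkb \<tau>" and c: "wkb_bound \<tau> c" and n: "of_nat n > - of_nat (wkb_ram \<tau>) * c"
  defines "F \<equiv> \<lambda>k. fps_nth (poly (wkb_amp \<tau>) (of_nat n)) k * q_powr (of_nat n * of_nat k / of_nat (wkb_ram \<tau>))"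
  shows "supp_ge ((c + of_nat n / of_nat (wkb_ram \<tau>)) * of_nat k0) (wkb_amp_eval \<tau> n - (\<Sum>k<k0. F k))"
  unfolding supp_ge_def
proof (intro allI impI, rule ccontr)
  define d where "d = c + of_nat n / of_nat (wkb_ram \<tau>)"
  have r: "wkb_ram \<tau> \<ge> 1" using \<tau> by (simp add: formal_wkb_def)
  have d: "d > 0" unfolding d_def by (rule add_divide_pos_rat[OF r n])
  have supp: "supp_ge (d * of_nat k) (F k)" for k
  proof -
    have "supp_ge (c * of_nat k) (wkb_phi \<tau> i k * of_nat n ^ i)" for i
    proof -
      have "supp_ge (c * of_nat k) (wkb_phi \<tau> i k)"
      proof (cases "wkb_phi \<tau> i k = 0")
        case False
        thus ?thesis using c puiseux_deg_le[OF False] unfolding wkb_bound_def supp_ge_def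
          by (meson order.trans)
      qed (simp add: supp_ge_def)
      from supp_ge_times[OF this supp_of_nat(1)[of "n ^ i"]] show ?thesis by simp
    qed
    hence "supp_ge (c * of_nat k) (fps_nth (poly (wkb_amp \<tau>) (of_nat n)) k)"
      unfolding fps_nth_poly_wkb_amp by (intro supp_ge_sum)
    moreover have "supp_ge (of_nat n * of_nat k / of_nat (wkb_ram \<tau>))
        (q_powr (of_nat n * of_nat k / of_nat (wkb_ram \<tau>)) :: K)"
      by (simp add: supp_ge_def puiseux_nth_q_powr)
    ultimately have "supp_ge (c * of_nat k + of_nat n * of_nat k / of_nat (wkb_ram \<tau>)) (F k)"
      unfolding F_def by (rule supp_ge_times)
    thus ?thesis by (simp add: d_def algebra_simps)
  qed
  fix x assume nz: "puiseux_nth (wkb_amp_eval \<tau> n - (\<Sum>k<k0. F k)) x \<noteq> 0"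
  assume "\<not> (c + of_nat n / of_nat (wkb_ram \<tau>)) * of_nat k0 \<le> x"
  hence x: "x < d * of_nat k0" by (simp add: d_def)
  have t: "(\<Sum>i\<le>degree (wkb_amp \<tau>).
     puiseux_nth (wkb_phi \<tau> i k) (x - of_nat n * of_nat k / of_nat (wkb_ram \<tau>)) * of_nat n ^ i) =
     puiseux_nth (F k) x" for k
    by (simp only: F_def puiseux_nth_times_q_powr fps_nth_poly_wkb_amp puiseux_nth_sum
        of_nat_power[symmetric] puiseux_nth_times_of_nat)
  have "{k. puiseux_nth (F k) x \<noteq> 0} \<subseteq> {..<k0}"
  proof
    fix k assume "k \<in> {k. puiseux_nth (F k) x \<noteq> 0}"
    hence "d * of_nat k \<le> x" using supp supp_geD by blast
    hence "d * of_nat k < d * of_nat k0" using x by linarith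
    thus "k \<in> {..<k0}" using d by simp
  qed
  hence "(\<Sum>k | puiseux_nth (F k) x \<noteq> 0. puiseux_nth (F k) x) = (\<Sum>k<k0. puiseux_nth (F k) x)"
    by (intro sum.mono_neutral_left) auto
  moreover have "puiseux_nth (wkb_amp_eval \<tau> n) x = (\<Sum>k | puiseux_nth (F k) x \<noteq> 0. puiseux_nth (F k) x)"
    using wkb_amp_eval_well_defined(2)[OF \<tau> c n, of x] unfolding t .
  ultimately show False using nz by (simp add: puiseux_nth_sum)
qed

text \<open>Splitting off the leading power \<beta> of \<open>wkb_lambda\<close> leaves \<nu> of
  degree 0. Term \<open>k\<close> of the amplitude then has slope \<open>\<beta> + k / r\<close>,
  with coefficients that are exponential polynomials by \<open>exp_poly_nth_power\<close>.\<close>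

lemma wkb_double_expansion:
  fixes \<tau> :: wkb and c :: K
  assumes \<tau>: "formal_wkb \<tau>"
  obtains R C \<alpha> U where "R \<ge> 1" "C \<ge> 0" "\<alpha> \<noteq> 0"
    "double_expansion R C {\<alpha>} (wkb_gamma \<tau>) U (\<lambda>n. c * wkb_eval \<tau> n)"
proof (cases "wkb_lambda \<tau> = 0")
  case True
  \<comment> \<open>The choice \<open>C = 0\<close> excludes \<open>n = 0\<close>, the only index at
    which \<open>0 ^ n\<close> is nonzero.\<close>
  have "double_expansion 1 0 {1} (wkb_gamma \<tau>) (\<lambda>_ _ _. 0) (\<lambda>n. c * wkb_eval \<tau> n)"
    using True by (auto simp: double_expansion_def exp_poly_0 wkb_eval_def zero_power)
  thus ?thesis using that[of 1 0 1] by simp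
next
  case False
  define r where "r = wkb_ram \<tau>"
  define \<beta> where "\<beta> = puiseux_deg (wkb_lambda \<tau>)"
  define \<nu> where "\<nu> = wkb_lambda \<tau> * q_powr (- \<beta>)"
  define \<alpha> where "\<alpha> = puiseux_nth \<nu> 0"
  define a where "a = puiseux_deg c"
  obtain e where e: "wkb_bound \<tau> e" using \<tau> by (auto simp: formal_wkb_def)
  obtain Rc where Rc: "Rc \<ge> 1" "supp_lattice Rc c" using supp_lattice_exists by blast
  define R where "R = r * Rc"
  have r: "r \<ge> 1" using \<tau> by (simp add: formal_wkb_def r_def)
  hence R: "R \<ge> 1" using Rc by (simp add: R_def Suc_le_eq)
  have \<alpha>: "\<alpha> = puiseux_lt (wkb_lambda \<tau>)"
    by (simp add: \<alpha>_def \<nu>_def \<beta>_def puiseux_nth_times_q_powr puiseux_lt_def)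
  hence \<alpha>0: "\<alpha> \<noteq> 0" using puiseux_lt_nonzero[OF False] by simp
  have lam_lat: "supp_lattice r (wkb_lambda \<tau>)"
    using \<tau> r by (intro supp_lattice_laurent_root) (simp_all add: formal_wkb_def r_def)
  have \<beta>r: "of_nat r * \<beta> \<in> \<int>"
    using supp_latticeD[OF lam_lat] puiseux_lt_nonzero[OF False] unfolding puiseux_lt_def \<beta>_def by blast
  have \<nu>r: "supp_lattice r \<nu>" unfolding \<nu>_def
  proof (rule supp_lattice_times[OF lam_lat])
    show "supp_lattice r (q_powr (- \<beta>) :: K)" using \<beta>r by (simp add: supp_lattice_def puiseux_nth_q_powr)
  qed
  have \<nu>0: "supp_ge 0 \<nu>"
    using supp_ge_times[OF supp_ge_deg[of "wkb_lambda \<tau>"], of "- \<beta>" "q_powr (- \<beta>)"]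
    by (simp add: supp_ge_def puiseux_nth_q_powr \<beta>_def[symmetric] \<nu>_def)
  have "wkb_lambda \<tau> = \<nu> * q_powr \<beta>" by (simp add: \<nu>_def mult.assoc q_powr_add q_powr_0)
  hence lam_pow: "wkb_lambda \<tau> ^ n = \<nu> ^ n * q_powr (of_nat n * \<beta>)" for n
    by (simp add: power_mult_distrib q_powr_power)
  define W where "W n k = c * \<nu> ^ n * fps_nth (poly (wkb_amp \<tau>) (of_nat n)) k" for n k
  have W: "W n k = (\<Sum>i\<le>degree (wkb_amp \<tau>). (c * wkb_phi \<tau> i k) * \<nu> ^ n * of_nat (n ^ i))" for n k
    unfolding W_def fps_nth_poly_wkb_amp sum_distrib_left by (simp add: algebra_simps)
  have \<phi>: "supp_ge (e * of_nat k) (wkb_phi \<tau> i k)" for i k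
  proof (cases "wkb_phi \<tau> i k = 0")
    case False
    thus ?thesis using e puiseux_deg_le[OF False] unfolding wkb_bound_def supp_ge_def
      by (meson order.trans)
  qed (simp add: supp_ge_def)
  have Wge: "supp_ge (a + e * of_nat k) (W n k)" for n k
  proof -
    have "supp_ge (a + e * of_nat k + of_nat n * 0 + 0) (c * wkb_phi \<tau> i k * \<nu> ^ n * of_nat (n ^ i))" for i
      unfolding a_def by (intro supp_ge_times supp_ge_deg \<phi> supp_ge_power \<nu>0 supp_of_nat)
    thus ?thesis unfolding W by (intro supp_ge_sum) simp
  qed
  have Wlat: "supp_lattice R (W n k)" for n k
  proof -
    have "supp_lattice R c" "supp_lattice R \<nu>"
      using supp_lattice_mono Rc(2) \<nu>r unfolding R_def by (metis dvd_triv_left dvd_triv_right)+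
    moreover have "supp_lattice r (wkb_phi \<tau> i k)" for i
      using \<tau> r by (intro supp_lattice_laurent_root) (simp_all add: formal_wkb_def r_def)
    hence "supp_lattice R (wkb_phi \<tau> i k)" for i using supp_lattice_mono unfolding R_def by (metis dvd_triv_left)
    ultimately show ?thesis unfolding W
      by (intro supp_lattice_sum supp_lattice_times supp_lattice_power supp_of_nat)
  qed
  have Wexp: "exp_poly {\<alpha>} (\<lambda>n. puiseux_nth (W n k) x)" for k x
  proof -
    have "exp_poly {\<alpha>} (\<lambda>n. poly (monom 1 i) (of_nat n) * puiseux_nth (c * wkb_phi \<tau> i k * \<nu> ^ n) x)" for i
      unfolding \<alpha>_def using \<alpha>0
      by (intro exp_poly_poly_mult exp_poly_nth_power[OF r \<nu>r \<nu>0]) (simp add: \<alpha>_def)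
    hence "exp_poly {\<alpha>} (\<lambda>n. \<Sum>i\<le>degree (wkb_amp \<tau>).
        poly (monom 1 i) (of_nat n) * puiseux_nth (c * wkb_phi \<tau> i k * \<nu> ^ n) x)"
      by (rule exp_poly_sum)
    moreover have "puiseux_nth (W n k) x = (\<Sum>i\<le>degree (wkb_amp \<tau>).
        poly (monom 1 i) (of_nat n) * puiseux_nth (c * wkb_phi \<tau> i k * \<nu> ^ n) x)" for n
      unfolding W puiseux_nth_sum puiseux_nth_times_of_nat by (simp add: poly_monom mult.commute)
    ultimately show ?thesis by simp
  qed
  define s where "s k = \<beta> + of_nat k / of_nat r" for k :: nat
  have inj_s: "inj s" using r by (auto simp: inj_on_def s_def)
  define U where "U n b x = (if b \<in> range s then puiseux_nth (W n (inv_into UNIV s b)) x else 0)" for n b x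
  have Us: "U n (s k) x = puiseux_nth (W n k) x" for n k x
    using inj_s by (simp add: U_def)
  have UE: "\<exists>k. b = s k" if "U n b x \<noteq> 0" for n b x
    using that by (auto simp: U_def split: if_splits)
  \<comment> \<open>The summand with \<open>e\<close> makes \<open>n > C\<close> imply
    \<open>n > - r * e\<close>, and it turns the bound \<open>a + e * k\<close> into one in terms of
    \<open>b\<close>, as \<open>k = r * (b - \<beta>)\<close>.\<close>
  define C where "C = \<bar>\<beta>\<bar> + \<bar>a\<bar> + \<bar>e\<bar> * of_nat r"
  have "0 \<le> \<bar>e\<bar> * of_nat r" by simp
  hence C: "C \<ge> 0" "- C \<le> \<beta>" "- C \<le> a" "\<bar>e\<bar> * of_nat r \<le> C"
    unfolding C_def by linarith+
  have bounds: "of_nat R * b \<in> \<int> \<and> of_nat R * x \<in> \<int> \<and> - C \<le> b \<and> - C * (b + C + 1) \<le> x"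
    if nz: "U n b x \<noteq> 0" for n b x
  proof -
    obtain k where k: "b = s k" using UE nz by blast
    hence nzW: "puiseux_nth (W n k) x \<noteq> 0" using nz Us by simp
    have "of_nat r * b = of_nat r * \<beta> + of_nat k" using r by (simp add: k s_def distrib_left)
    hence "of_nat r * b \<in> \<int>" using \<beta>r by simp
    hence "of_nat Rc * (of_nat r * b) \<in> \<int>" by (rule Ints_mult[OF Ints_of_nat])
    hence 1: "of_nat R * b \<in> \<int>" by (simp add: R_def algebra_simps)
    have 2: "of_nat R * x \<in> \<int>" using supp_latticeD[OF Wlat nzW] .
    have b\<beta>: "b - \<beta> = of_nat k / of_nat r" by (simp add: k s_def)
    moreover have "0 \<le> (of_nat k / of_nat r :: rat)" by simp
    ultimately have "b \<ge> \<beta>" by linarith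
    hence bC: "- C \<le> b" using C by linarith
    have "a + e * of_nat k \<le> x" using supp_geD[OF Wge nzW] .
    moreover have "- (\<bar>e\<bar> * of_nat k) \<le> e * of_nat k"
      using mult_right_mono[of "- \<bar>e\<bar>" e "of_nat k"] by simp
    moreover have "\<bar>e\<bar> * of_nat k = \<bar>e\<bar> * of_nat r * (b - \<beta>)" using r by (simp add: b\<beta>)
    moreover have "\<bar>e\<bar> * of_nat r * (b - \<beta>) \<le> C * (b + C)"
      using C \<open>b \<ge> \<beta>\<close> by (intro mult_mono) auto
    ultimately have "- C * (b + C + 1) \<le> x" using C by (simp add: algebra_simps)
    with 1 2 bC show ?thesis by blast
  qed
  have "double_expansion R C {\<alpha>} (wkb_gamma \<tau>) U (\<lambda>n. c * wkb_eval \<tau> n)"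
    unfolding double_expansion_def
  proof (intro conjI allI impI)
    fix n b x
    show "exp_poly {\<alpha>} (\<lambda>n. U n b x)"
    proof (cases "b \<in> range s")
      case True
      then obtain k where "b = s k" by blast
      thus ?thesis using Wexp Us by simp
    qed (simp add: U_def exp_poly_0)
    assume "U n b x \<noteq> 0"
    thus "of_nat R * b \<in> \<int>" "of_nat R * x \<in> \<int>" "- C \<le> b" "- C * (b + C + 1) \<le> x"
      using bounds by blast+
  next
    fix n z assume n: "of_nat n > C"
    have "- of_nat r * e \<le> \<bar>e\<bar> * of_nat r" using mult_right_mono[of "- e" "\<bar>e\<bar>" "of_nat r"] by (simp add: mult.commute)
    hence n': "of_nat n > - of_nat r * e" using n C by linarith
    define d where "d = e + of_nat n / of_nat r"
    have d: "d > 0" unfolding d_def by (rule add_divide_pos_rat[OF r n'])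
    define y where "y = z - of_nat n * \<beta>"
    \<comment> \<open>Large enough that \<open>y < a + d * k0\<close>, so the remainder after
      \<open>k0\<close> terms does not reach \<open>y\<close>.\<close>
    define k0 where "k0 = Suc (nat \<lceil>(y - a) / d\<rceil>)"
    have "(y - a) / d < of_nat k0" unfolding k0_def by linarith
    hence "y - a < of_nat k0 * d" using d by (subst (asm) pos_divide_less_eq) simp_all
    hence k0: "y < a + d * of_nat k0" by (simp add: mult.commute)
    define F where "F k = fps_nth (poly (wkb_amp \<tau>) (of_nat n)) k * q_powr (of_nat n * of_nat k / of_nat r)" for k
    define Rem where "Rem = wkb_amp_eval \<tau> n - (\<Sum>k<k0. F k)"
    have "supp_ge (d * of_nat k0) Rem" unfolding Rem_def F_def d_def r_def
      by (rule wkb_amp_eval_truncation[OF \<tau> e]) (use n' r_def in simp)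
    hence "supp_ge (a + of_nat n * 0 + d * of_nat k0) (c * \<nu> ^ n * Rem)"
      unfolding a_def by (intro supp_ge_times supp_ge_deg supp_ge_power \<nu>0)
    hence rem0: "puiseux_nth (c * \<nu> ^ n * Rem) y = 0" using k0 by (intro supp_ge_eq_0) auto
    have "c * wkb_eval \<tau> n = (c * \<nu> ^ n * wkb_amp_eval \<tau> n) * q_powr (wkb_gamma \<tau> * of_nat n ^ 2 + of_nat n * \<beta>)"
      unfolding wkb_eval_def lam_pow q_powr_add[symmetric] by (simp only: mult_ac)
    hence "puiseux_nth (c * wkb_eval \<tau> n) (wkb_gamma \<tau> * of_nat n ^ 2 + z) =
        puiseux_nth (c * \<nu> ^ n * wkb_amp_eval \<tau> n) y"
      by (simp only: puiseux_nth_times_q_powr y_def) (simp add: algebra_simps)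
    also have "wkb_amp_eval \<tau> n = (\<Sum>k<k0. F k) + Rem" by (simp add: Rem_def)
    also have "c * \<nu> ^ n * ((\<Sum>k<k0. F k) + Rem) =
       (\<Sum>k<k0. W n k * q_powr (of_nat n * of_nat k / of_nat r)) + c * \<nu> ^ n * Rem"
      by (simp add: distrib_left sum_distrib_left F_def W_def mult.assoc)
    also have "puiseux_nth \<dots> y = (\<Sum>k<k0. puiseux_nth (W n k) (y - of_nat n * of_nat k / of_nat r))"
      by (simp only: puiseux_nth_add rem0 puiseux_nth_sum puiseux_nth_times_q_powr add_0_right)
    also have "\<dots> = (\<Sum>k<k0. U n (s k) (z - s k * of_nat n))"
      unfolding Us by (simp add: y_def s_def algebra_simps)
    also have "\<dots> = (\<Sum>b\<in>s ` {..<k0}. U n b (z - b * of_nat n))"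
      by (subst sum.reindex) (use inj_s inj_on_subset in \<open>auto simp: o_def\<close>)
    \<comment> \<open>Both index sets contain all nonzero terms: a slope with
      \<open>k \<ge> k0\<close> would violate the support bound, one outside
      \<open>expansion_slopes\<close> would violate \<open>bounds\<close>.\<close>
    also have "\<dots> = (\<Sum>b\<in>expansion_slopes R C n z. U n b (z - b * of_nat n))"
    proof (rule sum.mono_neutral_cong[OF finite_expansion_slopes[OF R n]])
      fix b assume b: "b \<in> expansion_slopes R C n z - s ` {..<k0}"
      show "U n b (z - b * of_nat n) = 0"
      proof (rule ccontr)
        assume nz: "U n b (z - b * of_nat n) \<noteq> 0"
        then obtain k where k: "b = s k" using UE by blast
        hence "a + e * of_nat k \<le> z - s k * of_nat n" using nz Us supp_geD[OF Wge] by metis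
        hence "a + d * of_nat k \<le> y" by (simp add: s_def d_def y_def algebra_simps)
        moreover have "d * of_nat k0 \<le> d * of_nat k" using b k d by (auto intro!: mult_left_mono)
        ultimately show False using k0 by linarith
      qed
    next
      fix b assume "b \<in> s ` {..<k0} - expansion_slopes R C n z"
      thus "U n b (z - b * of_nat n) = 0"
        using bounds[of n b "z - b * of_nat n"] by (auto simp: expansion_slopes_def)
    qed simp_all
    finally show "puiseux_nth (c * wkb_eval \<tau> n) (wkb_gamma \<tau> * of_nat n ^ 2 + z) =
        (\<Sum>b\<in>expansion_slopes R C n z. U n b (z - b * of_nat n))" .
  qed
  thus ?thesis using that R C \<alpha>0 by blast
qed

section \<open>Leading terms\<close>

lemma lattice_has_min:
  fixes S :: "rat set"
  assumes "R \<ge> 1" "S \<noteq> {}" "\<And>x. x \<in> S \<Longrightarrow> of_nat R * x \<in> \<int> \<and> l \<le> x"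
  obtains m where "m \<in> S" "\<And>x. x \<in> S \<Longrightarrow> m \<le> x"
proof -
  obtain u where u: "u \<in> S" using assms(2) by blast
  define Y where "Y = {x \<in> S. x \<le> u}"
  have "finite Y"
    by (rule finite_subset[OF _ finite_lattice_interval[OF assms(1), of l u]]) (use assms(3) in \<open>auto simp: Y_def\<close>)
  moreover have "u \<in> Y" using u by (simp add: Y_def)
  ultimately have Y: "Min Y \<in> Y" "\<And>x. x \<in> Y \<Longrightarrow> Min Y \<le> x" by (auto intro: Min_in)
  have "Min Y \<le> x" if "x \<in> S" for x
  proof (cases "x \<le> u")
    case False
    thus ?thesis using Y(2)[OF \<open>u \<in> Y\<close>] by linarith
  qed (use that Y(2) in \<open>simp add: Y_def\<close>)
  moreover have "Min Y \<in> S" using Y(1) by (simp add: Y_def)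
  ultimately show ?thesis using that by blast
qed

lemma lattice_gap:
  fixes b b' :: rat
  assumes "R \<ge> 1" "of_nat R * b \<in> \<int>" "of_nat R * b' \<in> \<int>" "b < b'"
  shows "b + 1 / of_nat R \<le> b'"
proof -
  obtain i j where ij: "of_nat R * b = of_int i" "of_nat R * b' = of_int j"
    using assms(2,3) by (auto elim!: Ints_cases)
  have "of_nat R * b < of_nat R * b'" using assms(1,4) by simp
  hence "i + 1 \<le> j" unfolding ij by simp
  hence "of_nat R * b + 1 \<le> of_nat R * b'" unfolding ij by linarith
  hence "of_nat R * (b + 1 / of_nat R) \<le> of_nat R * b'" using assms(1) by (simp add: distrib_left)
  thus ?thesis using assms(1) by simp
qed

lemma eventually_of_nat_gt: "eventually (\<lambda>n. of_nat n > (c::rat)) sequentially"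
proof -
  obtain N where "c < of_nat N" using reals_Archimedean2 by blast
  thus ?thesis unfolding eventually_sequentially
    by (intro exI[of _ N] allI impI) (meson less_le_trans of_nat_mono)
qed

lemma eventually_quadratic_gt:
  fixes \<delta> p q :: rat
  assumes "\<delta> > 0"
  shows "eventually (\<lambda>n. p * of_nat n + q < \<delta> * of_nat n ^ 2) sequentially"
  using eventually_of_nat_gt[of "(\<bar>p\<bar> + \<bar>q\<bar>) / \<delta>"] eventually_gt_at_top[of 0]
proof eventually_elim
  case (elim n)
  have n: "(1::rat) \<le> of_nat n" using elim(2) by simp
  have "\<bar>p\<bar> + \<bar>q\<bar> < of_nat n * \<delta>" using elim(1) assms by (subst (asm) pos_divide_less_eq) simp_all
  hence "(\<bar>p\<bar> + \<bar>q\<bar>) * of_nat n < of_nat n * \<delta> * of_nat n" using n by (intro mult_strict_right_mono) auto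
  moreover have "p * of_nat n \<le> \<bar>p\<bar> * of_nat n" by (intro mult_right_mono) auto
  moreover have "q \<le> \<bar>q\<bar> * of_nat n" using n mult_left_mono[of 1 "of_nat n" "\<bar>q\<bar>"] by linarith
  ultimately show ?case by (simp add: power2_eq_square algebra_simps)
qed

lemma puiseux_deg_eqI:
  assumes "supp_ge y f" "puiseux_nth f y \<noteq> 0"
  shows "puiseux_deg f = y" "puiseux_lt f = puiseux_nth f y"
proof -
  show "puiseux_deg f = y" unfolding puiseux_deg_def
    by (rule Least_equality) (use assms supp_geD in auto)
  thus "puiseux_lt f = puiseux_nth f y" by (simp add: puiseux_lt_def)
qed

text \<open>A pair contributes at \<open>b * n + x\<close>, at least
  \<open>b * (n - C) - C * (C + 1)\<close>, and \<open>b \<ge> - C\<close>. The loss is linear in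
  \<open>n\<close>, so a larger \<gamma> is eventually negligible.\<close>

lemma double_expansion_supp_ge:
  assumes exp: "double_expansion R C A \<gamma> U g" and n: "of_nat n > C"
  shows "supp_ge (\<gamma> * of_nat n ^ 2 - C * of_nat n - C) (g n)"
  unfolding supp_ge_def
proof (intro allI impI)
  fix y assume y: "puiseux_nth (g n) y \<noteq> 0"
  define z where "z = y - \<gamma> * of_nat n ^ 2"
  have "puiseux_nth (g n) (\<gamma> * of_nat n ^ 2 + z) \<noteq> 0" using y by (simp add: z_def)
  hence "(\<Sum>b\<in>expansion_slopes R C n z. U n b (z - b * of_nat n)) \<noteq> 0"
    unfolding double_expansionD(6)[OF exp n] .
  then obtain b where "U n b (z - b * of_nat n) \<noteq> 0" by (rule sum.not_neutral_contains_not_neutral)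
  note b = double_expansionD(3,4)[OF exp this]
  have "- C * (of_nat n - C) \<le> b * (of_nat n - C)" using b(1) n by (intro mult_right_mono) auto
  hence "- C * of_nat n - C \<le> z" using b(2) by (simp add: algebra_simps)
  thus "\<gamma> * of_nat n ^ 2 - C * of_nat n - C \<le> y" by (simp add: z_def)
qed

text \<open>The lexicographically least pair \<open>(b0, x0)\<close> occurring in the residue class
  dominates: larger slopes lose for large \<open>n\<close>, and no smaller \<open>x\<close> occurs
  at slope \<open>b0\<close>. The Skolem period keeps its coefficient nonzero for large
  \<open>n\<close>.\<close>

lemma double_expansion_leading:
  assumes exp: "double_expansion R C A \<gamma> U g" and R: "R \<ge> 1" and T: "skolem_period A T"
  obtains (zero) "\<And>n. of_nat n > C \<Longrightarrow> n mod T = \<rho> \<Longrightarrow> g n = 0"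
  | (lead) b x where "eventually (\<lambda>n. n mod T = \<rho> \<longrightarrow> U n b x \<noteq> 0 \<and>
       supp_ge (\<gamma> * of_nat n ^ 2 + (b * of_nat n + x)) (g n) \<and>
       puiseux_nth (g n) (\<gamma> * of_nat n ^ 2 + (b * of_nat n + x)) = U n b x) sequentially"
proof (cases "\<exists>n b x. n mod T = \<rho> \<and> U n b x \<noteq> 0")
  case False
  have "g n = 0" if n: "of_nat n > C" and \<rho>: "n mod T = \<rho>" for n
  proof (rule puiseux_eqI)
    fix y
    have "puiseux_nth (g n) (\<gamma> * of_nat n ^ 2 + (y - \<gamma> * of_nat n ^ 2)) = 0"
      unfolding double_expansionD(6)[OF exp n] using False \<rho> by (intro sum.neutral) blast
    thus "puiseux_nth (g n) y = puiseux_nth 0 y" by simp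
  qed
  thus ?thesis by (rule zero)
next
  case True
  define Bs where "Bs = {b. \<exists>n x. n mod T = \<rho> \<and> U n b x \<noteq> 0}"
  have "Bs \<noteq> {}" using True by (auto simp: Bs_def)
  then obtain b0 where b0: "b0 \<in> Bs" "\<And>b. b \<in> Bs \<Longrightarrow> b0 \<le> b"
    by (rule lattice_has_min[OF R, of _ "- C"]) (use double_expansionD[OF exp] in \<open>auto simp: Bs_def\<close>)
  define Xs where "Xs = {x. \<exists>n. n mod T = \<rho> \<and> U n b0 x \<noteq> 0}"
  have "Xs \<noteq> {}" using b0(1) by (auto simp: Xs_def Bs_def)
  then obtain x0 where x0: "x0 \<in> Xs" "\<And>x. x \<in> Xs \<Longrightarrow> x0 \<le> x"
    by (rule lattice_has_min[OF R, of _ "- C * (b0 + C + 1)"])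
      (use double_expansionD(2,4)[OF exp] in \<open>auto simp: Xs_def\<close>)
  obtain n0 where n0: "n0 mod T = \<rho>" "U n0 b0 x0 \<noteq> 0" using x0(1) by (auto simp: Xs_def)
  have "finite {m. U (\<rho> + T * m) b0 x0 = 0}"
  proof (rule ccontr)
    assume "infinite {m. U (\<rho> + T * m) b0 x0 = 0}"
    hence "U (\<rho> + T * (n0 div T)) b0 x0 = 0"
      using T double_expansionD(5)[OF exp, of b0 x0] unfolding skolem_period_def by blast
    thus False using n0 by (metis mod_mult_div_eq)
  qed
  then obtain M where M: "\<And>m. U (\<rho> + T * m) b0 x0 = 0 \<Longrightarrow> m \<le> M"
    unfolding finite_nat_set_iff_bounded_le by blast
  have ev: "eventually (\<lambda>n. n \<ge> T * Suc M) sequentially" by (rule eventually_ge_at_top)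
  have "eventually (\<lambda>n. n mod T = \<rho> \<longrightarrow> U n b0 x0 \<noteq> 0 \<and>
       supp_ge (\<gamma> * of_nat n ^ 2 + (b0 * of_nat n + x0)) (g n) \<and>
       puiseux_nth (g n) (\<gamma> * of_nat n ^ 2 + (b0 * of_nat n + x0)) = U n b0 x0) sequentially"
    \<comment> \<open>The last threshold makes \<open>(b0 + 1 / R) * (n - C) - C * (C + 1)\<close>,
      a lower bound for the contributions of slopes above \<open>b0\<close>, exceed
      \<open>b0 * n + x0\<close>.\<close>
    using ev eventually_of_nat_gt[of C]
      eventually_of_nat_gt[of "of_nat R * (x0 + b0 * C + C / of_nat R + C * (C + 1))"]
  proof eventually_elim
    case (elim n)
    have "U n b0 x0 \<noteq> 0 \<and>
       supp_ge (\<gamma> * of_nat n ^ 2 + (b0 * of_nat n + x0)) (g n) \<and>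
       puiseux_nth (g n) (\<gamma> * of_nat n ^ 2 + (b0 * of_nat n + x0)) = U n b0 x0"
      if rho: "n mod T = \<rho>"
    proof -
      have "U n b0 x0 \<noteq> 0"
      proof
        assume "U n b0 x0 = 0"
        hence "n div T \<le> M" using M[of "n div T"] rho by (metis mod_mult_div_eq)
        moreover have "Suc M \<le> n div T" using elim(1) T by (simp add: skolem_period_def less_eq_div_iff_mult_less_eq mult.commute)
        ultimately show False by simp
      qed
      \<comment> \<open>Up to \<open>b0 * n + x0\<close> no other pair has a nonzero coefficient, so
        nothing can cancel the leading one.\<close>
      have single: "b = b0 \<and> z = b0 * of_nat n + x0"
        if z: "z \<le> b0 * of_nat n + x0" and nz: "U n b (z - b * of_nat n) \<noteq> 0" for b z
      proof -
        have "b \<in> Bs" using nz rho by (auto simp: Bs_def)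
        have "b = b0"
        proof (rule ccontr)
          assume "b \<noteq> b0"
          hence "b0 < b" using b0(2)[OF \<open>b \<in> Bs\<close>] by simp
          hence "b0 + 1 / of_nat R \<le> b"
            using b0(1) nz double_expansionD(1)[OF exp] by (intro lattice_gap R) (auto simp: Bs_def)
          hence "(b0 + 1 / of_nat R) * (of_nat n - C) \<le> b * (of_nat n - C)"
            using elim(2) by (intro mult_right_mono) auto
          moreover have "- C * (b + C + 1) \<le> z - b * of_nat n" using double_expansionD(4)[OF exp nz] .
          hence "b * (of_nat n - C) - C * (C + 1) \<le> z" by (simp add: algebra_simps)
          moreover have "x0 + b0 * C + C / of_nat R + C * (C + 1) < of_nat n / of_nat R"
            using elim(3) R by (subst pos_less_divide_eq) (simp_all add: mult.commute)
          moreover have "(b0 + 1 / of_nat R) * (of_nat n - C) =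
              b0 * of_nat n - b0 * C + of_nat n / of_nat R - C / of_nat R"
            by (simp add: algebra_simps diff_divide_distrib)
          ultimately show False using z by linarith
        qed
        moreover from this have "z - b0 * of_nat n \<in> Xs" using nz rho by (auto simp: Xs_def)
        hence "x0 \<le> z - b0 * of_nat n" by (rule x0(2))
        ultimately show ?thesis using z by simp
      qed
      have R0: "puiseux_nth (g n) (\<gamma> * of_nat n ^ 2 + z) = 0" if "z < b0 * of_nat n + x0" for z
        unfolding double_expansionD(6)[OF exp elim(2)]
        by (rule sum.neutral) (use single[of z] that in force)
      have "supp_ge (\<gamma> * of_nat n ^ 2 + (b0 * of_nat n + x0)) (g n)"
        unfolding supp_ge_def
      proof (intro allI impI, rule ccontr)
        fix y assume y: "puiseux_nth (g n) y \<noteq> 0" and "\<not> \<gamma> * of_nat n ^ 2 + (b0 * of_nat n + x0) \<le> y"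
        thus False using R0[of "y - \<gamma> * of_nat n ^ 2"] by simp
      qed
      moreover have "puiseux_nth (g n) (\<gamma> * of_nat n ^ 2 + (b0 * of_nat n + x0)) = U n b0 x0"
      proof -
        let ?z = "b0 * of_nat n + x0"
        have "b0 \<in> expansion_slopes R C n ?z"
          using double_expansionD(1,3,4)[OF exp \<open>U n b0 x0 \<noteq> 0\<close>] by (simp add: expansion_slopes_def)
        hence "(\<Sum>b\<in>expansion_slopes R C n ?z. U n b (?z - b * of_nat n)) = (\<Sum>b\<in>{b0}. U n b (?z - b * of_nat n))"
          using single[of ?z] by (intro sum.mono_neutral_right finite_expansion_slopes[OF R elim(2)]) auto
        thus ?thesis unfolding double_expansionD(6)[OF exp elim(2)] by simp
      qed
      ultimately show ?thesis using \<open>U n b0 x0 \<noteq> 0\<close> by blast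
    qed
    thus ?case by blast
  qed
  thus ?thesis by (rule lead)
qed

text \<open>Among the \<gamma> whose series does not vanish on the residue class, the smallest
  prevails: the quadratic gap to the others exceeds every linear loss.\<close>

lemma sum_double_expansions_leading:
  fixes g :: "rat \<Rightarrow> nat \<Rightarrow> 'a::field_char_0 puiseux"
  assumes \<Gamma>: "finite \<Gamma>" and exp: "\<And>\<gamma>. \<gamma> \<in> \<Gamma> \<Longrightarrow> double_expansion R C A \<gamma> (U \<gamma>) (g \<gamma>)"
    and R: "R \<ge> 1" and T: "skolem_period A T"
    and f: "\<And>n. f n = (\<Sum>\<gamma>\<in>\<Gamma>. g \<gamma> n)"
  shows "\<exists>a b e t. exp_poly A t \<and> eventually (\<lambda>n. n mod T = \<rho> \<longrightarrow>
    (f n \<noteq> 0 \<longrightarrow> puiseux_deg (f n) = a * of_nat n ^ 2 + b * of_nat n + e) \<and> puiseux_lt (f n) = t n) sequentially"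
proof -
  define vanish where "vanish \<gamma> \<longleftrightarrow> (\<forall>n. of_nat n > C \<longrightarrow> n mod T = \<rho> \<longrightarrow> g \<gamma> n = 0)" for \<gamma>
  define \<Gamma>' where "\<Gamma>' = {\<gamma> \<in> \<Gamma>. \<not> vanish \<gamma>}"
  have fin: "finite \<Gamma>'" using \<Gamma> by (simp add: \<Gamma>'_def)
  have f': "f n = (\<Sum>\<gamma>\<in>\<Gamma>'. g \<gamma> n)" if "of_nat n > C" "n mod T = \<rho>" for n
    unfolding f using \<Gamma> that by (intro sum.mono_neutral_right) (auto simp: \<Gamma>'_def vanish_def)
  show ?thesis
  proof (cases "\<Gamma>' = {}")
    case True
    \<comment> \<open>Here \<open>f n\<close> is eventually 0 on the class: the degree claim is
      vacuous, and \<open>puiseux_lt 0 = 0\<close> matches the zero exponential polynomial.\<close>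
    have "eventually (\<lambda>n. n mod T = \<rho> \<longrightarrow>
      (f n \<noteq> 0 \<longrightarrow> puiseux_deg (f n) = 0 * of_nat n ^ 2 + 0 * of_nat n + 0) \<and> puiseux_lt (f n) = 0) sequentially"
      using eventually_of_nat_gt[of C]
    proof eventually_elim
      case (elim n)
      thus ?case using f'[OF elim] True by (simp add: puiseux_lt_def)
    qed
    thus ?thesis using exp_poly_0 by blast
  next
    case False
    define \<gamma>0 where "\<gamma>0 = Min \<Gamma>'"
    have \<gamma>0: "\<gamma>0 \<in> \<Gamma>'" "\<And>\<gamma>. \<gamma> \<in> \<Gamma>' \<Longrightarrow> \<gamma>0 \<le> \<gamma>" using False fin by (auto simp: \<gamma>0_def)
    have exp0: "double_expansion R C A \<gamma>0 (U \<gamma>0) (g \<gamma>0)" and "\<not> vanish \<gamma>0"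
      using \<gamma>0(1) exp by (auto simp: \<Gamma>'_def)
    obtain b x where lead: "eventually (\<lambda>n. n mod T = \<rho> \<longrightarrow> U \<gamma>0 n b x \<noteq> 0 \<and>
       supp_ge (\<gamma>0 * of_nat n ^ 2 + (b * of_nat n + x)) (g \<gamma>0 n) \<and>
       puiseux_nth (g \<gamma>0 n) (\<gamma>0 * of_nat n ^ 2 + (b * of_nat n + x)) = U \<gamma>0 n b x) sequentially"
      using double_expansion_leading[OF exp0 R T, of \<rho>] \<open>\<not> vanish \<gamma>0\<close> unfolding vanish_def by metis
    have "eventually (\<lambda>n. (b + C) * of_nat n + (x + C) < (\<gamma> - \<gamma>0) * of_nat n ^ 2) sequentially"
      if "\<gamma> \<in> \<Gamma>' - {\<gamma>0}" for \<gamma>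
      using \<gamma>0(2)[of \<gamma>] that by (intro eventually_quadratic_gt) auto
    hence "eventually (\<lambda>n. \<forall>\<gamma>\<in>\<Gamma>' - {\<gamma>0}. (b + C) * of_nat n + (x + C) < (\<gamma> - \<gamma>0) * of_nat n ^ 2) sequentially"
      using fin by (intro eventually_ball_finite) auto
    with lead eventually_of_nat_gt[of C]
    have "eventually (\<lambda>n. n mod T = \<rho> \<longrightarrow>
      (f n \<noteq> 0 \<longrightarrow> puiseux_deg (f n) = \<gamma>0 * of_nat n ^ 2 + b * of_nat n + x) \<and>
      puiseux_lt (f n) = U \<gamma>0 n b x) sequentially"
    proof eventually_elim
      case (elim n)
      let ?y = "\<gamma>0 * of_nat n ^ 2 + (b * of_nat n + x)"
      have "(f n \<noteq> 0 \<longrightarrow> puiseux_deg (f n) = \<gamma>0 * of_nat n ^ 2 + b * of_nat n + x) \<and>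
          puiseux_lt (f n) = U \<gamma>0 n b x" if rho: "n mod T = \<rho>"
      proof -
        have f0: "f n = g \<gamma>0 n + (\<Sum>\<gamma>\<in>\<Gamma>' - {\<gamma>0}. g \<gamma> n)"
          using f'[OF elim(2) rho] sum.remove[OF fin \<gamma>0(1), of "\<lambda>\<gamma>. g \<gamma> n"] by simp
        have rest: "supp_ge (\<gamma> * of_nat n ^ 2 - C * of_nat n - C) (g \<gamma> n)" 
            "?y < \<gamma> * of_nat n ^ 2 - C * of_nat n - C" if "\<gamma> \<in> \<Gamma>' - {\<gamma>0}" for \<gamma>
        proof -
          show "supp_ge (\<gamma> * of_nat n ^ 2 - C * of_nat n - C) (g \<gamma> n)"
            using that elim(2) exp by (intro double_expansion_supp_ge) (auto simp: \<Gamma>'_def)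
          have "(b + C) * of_nat n + (x + C) < (\<gamma> - \<gamma>0) * of_nat n ^ 2" using elim(3) that by blast
          thus "?y < \<gamma> * of_nat n ^ 2 - C * of_nat n - C" by (simp add: algebra_simps)
        qed
        have zero: "puiseux_nth (\<Sum>\<gamma>\<in>\<Gamma>' - {\<gamma>0}. g \<gamma> n) y = 0" if "y \<le> ?y" for y
          unfolding puiseux_nth_sum
        proof (rule sum.neutral, intro ballI)
          fix \<gamma> assume "\<gamma> \<in> \<Gamma>' - {\<gamma>0}"
          note rest[OF this]
          thus "puiseux_nth (g \<gamma> n) y = 0" using that by (intro supp_ge_eq_0) auto
        qed
        have nth: "puiseux_nth (f n) y = puiseux_nth (g \<gamma>0 n) y" if "y \<le> ?y" for y
          unfolding f0 puiseux_nth_add using zero[OF that] by simp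
        have sg: "supp_ge ?y (g \<gamma>0 n)" and U: "U \<gamma>0 n b x \<noteq> 0" "puiseux_nth (g \<gamma>0 n) ?y = U \<gamma>0 n b x"
          using elim(1) rho by auto
        have "supp_ge ?y (f n)"
          unfolding supp_ge_def
        proof (intro allI impI, rule ccontr)
          fix y assume "puiseux_nth (f n) y \<noteq> 0" "\<not> ?y \<le> y"
          thus False using nth[of y] supp_ge_eq_0[OF sg, of y] by simp
        qed
        from puiseux_deg_eqI[OF this] show ?thesis using nth[of ?y] U by (simp add: algebra_simps)
      qed
      thus ?case by blast
    qed
    thus ?thesis using double_expansionD(5)[OF exp0] by blast
  qed
qed

section \<open>Combining the series\<close>

lemma algebraic_qbar: "algebraic (x :: qbar)"
proof -
  obtain p :: "rat poly" where p: "p \<noteq> 0" "poly (map_poly to_ac p) x = 0"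
    by (rule alg_closure_algebraic)
  have "coeff (map_poly to_ac p) i \<in> \<rat>" for i
  proof -
    obtain a b where "quotient_of (coeff p i) = (a, b)" by force
    hence "coeff p i = of_int a / of_int b" by (rule quotient_of_div)
    thus ?thesis by (simp add: coeff_map_poly)
  qed
  moreover have "map_poly to_ac p \<noteq> 0" using p(1) by (simp add: map_poly_eq_0_iff)
  ultimately show ?thesis using p(2) by (intro algebraicI'[of "map_poly to_ac p"])
qed

text \<open>The degree clause is confined to \<open>f n \<noteq> 0\<close> because
  \<open>puiseux_deg 0\<close> is unspecified; the recursion also covers \<open>f n = 0\<close>,
  where \<open>puiseux_lt\<close> is 0.\<close>

theorem theorem1p10:
  fixes m :: nat and c :: "nat \<Rightarrow> K" and \<tau> :: "nat \<Rightarrow> wkb" and f :: "nat \<Rightarrow> K"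
  assumes "\<And>i. i \<in> {1..m} \<Longrightarrow> formal_wkb (\<tau> i)"
    and "\<And>n. f n = (\<Sum>i=1..m. c i * wkb_eval (\<tau> i) n)"
  shows "(\<exists>p. quadratic_quasi_polynomial p \<and>
            eventually (\<lambda>n. f n \<noteq> 0 \<longrightarrow> puiseux_deg (f n) = p n) sequentially) \<and>
         eventually_linear_recursive (\<lambda>n. puiseux_lt (f n))"
proof -
  let ?I = "{1..m}"
  have "\<forall>i\<in>?I. \<exists>R C \<alpha> U. R \<ge> 1 \<and> C \<ge> 0 \<and> \<alpha> \<noteq> 0 \<and>
     double_expansion R C {\<alpha>} (wkb_gamma (\<tau> i)) U (\<lambda>n. c i * wkb_eval (\<tau> i) n)"
    using wkb_double_expansion[OF assms(1)] by metis
  then obtain Ri Ci \<alpha>i Ui where i: "\<And>i. i \<in> ?I \<Longrightarrow> Ri i \<ge> 1" "\<And>i. i \<in> ?I \<Longrightarrow> Ci i \<ge> 0"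
    "\<And>i. i \<in> ?I \<Longrightarrow> \<alpha>i i \<noteq> 0"
    "\<And>i. i \<in> ?I \<Longrightarrow> double_expansion (Ri i) (Ci i) {\<alpha>i i} (wkb_gamma (\<tau> i)) (Ui i) (\<lambda>n. c i * wkb_eval (\<tau> i) n)"
    by metis
  define R where "R = prod Ri ?I"
  define C where "C = sum Ci ?I"
  define A where "A = \<alpha>i ` ?I"
  define \<Gamma> where "\<Gamma> = (\<lambda>i. wkb_gamma (\<tau> i)) ` ?I"
  \<comment> \<open>Series with equal \<gamma> are added first, since their leading terms may
    cancel; different \<gamma> separate by growth.\<close>
  define g where "g \<gamma> n = (\<Sum>i | i \<in> ?I \<and> wkb_gamma (\<tau> i) = \<gamma>. c i * wkb_eval (\<tau> i) n)" for \<gamma> n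
  have R: "R \<ge> 1" 
  proof -
    have "prod Ri ?I > 0" by (rule prod_pos) (use i(1) in force)
    thus ?thesis by (simp only: R_def Suc_le_eq One_nat_def)
  qed
  have A: "finite A" "0 \<notin> A" using i(3) by (auto simp: A_def)
  have exp: "double_expansion R C A (wkb_gamma (\<tau> i)) (Ui i) (\<lambda>n. c i * wkb_eval (\<tau> i) n)" if "i \<in> ?I" for i
  proof (rule double_expansion_mono[OF i(4)[OF that]])
    show "Ri i dvd R" "Ci i \<le> C" "{\<alpha>i i} \<subseteq> A"
      using that i(2) member_le_sum[of i ?I Ci] by (auto simp: R_def C_def A_def)
  qed (use R A i(2) that in auto)
  define U where "U \<gamma> n b x = (\<Sum>i | i \<in> ?I \<and> wkb_gamma (\<tau> i) = \<gamma>. Ui i n b x)" for \<gamma> n b x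
  have expg: "double_expansion R C A \<gamma> (U \<gamma>) (g \<gamma>)" for \<gamma>
    unfolding g_def[abs_def] U_def[abs_def] using exp by (intro double_expansion_sum) auto
  have "finite \<Gamma>" by (simp add: \<Gamma>_def)
  have f: "f n = (\<Sum>\<gamma>\<in>\<Gamma>. g \<gamma> n)" for n
    unfolding assms(2) g_def \<Gamma>_def by (rule sum.image_gen) simp
  \<comment> \<open>One period for all bases makes the residue classes common to every \<gamma> and
    to both conclusions.\<close>
  obtain T where T: "skolem_period A T"
    using skolem_mahler_lech_uniform[OF A(1) algebraic_qbar A(2)] by blast
  hence T0: "T > 0" by (simp add: skolem_period_def)
  have "\<forall>\<rho>. \<exists>a b e t. exp_poly A t \<and> eventually (\<lambda>n. n mod T = \<rho> \<longrightarrow>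
    (f n \<noteq> 0 \<longrightarrow> puiseux_deg (f n) = a * of_nat n ^ 2 + b * of_nat n + e) \<and> puiseux_lt (f n) = t n) sequentially"
    by (intro allI sum_double_expansions_leading[where U = U, OF \<open>finite \<Gamma>\<close> expg R T f])
  then obtain a b e t where t: "\<And>\<rho>. exp_poly A (t \<rho>)" and ev: "\<And>\<rho>. eventually (\<lambda>n. n mod T = \<rho> \<longrightarrow>
    (f n \<noteq> 0 \<longrightarrow> puiseux_deg (f n) = a \<rho> * of_nat n ^ 2 + b \<rho> * of_nat n + e \<rho>) \<and>
    puiseux_lt (f n) = t \<rho> n) sequentially"
    unfolding choice_iff by blast
  have "eventually (\<lambda>n. \<forall>\<rho>\<in>{..<T}. n mod T = \<rho> \<longrightarrow>
    (f n \<noteq> 0 \<longrightarrow> puiseux_deg (f n) = a \<rho> * of_nat n ^ 2 + b \<rho> * of_nat n + e \<rho>) \<and>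
    puiseux_lt (f n) = t \<rho> n) sequentially"
    using ev by (intro eventually_ball_finite) auto
  hence "eventually (\<lambda>n. f n \<noteq> 0 \<longrightarrow>
      puiseux_deg (f n) = a (n mod T) * of_nat n ^ 2 + b (n mod T) * of_nat n + e (n mod T)) sequentially"
    by eventually_elim (use T0 in simp)
  moreover have "eventually_linear_recursive (\<lambda>n. puiseux_lt (f n))"
  proof (rule piecewise_exp_poly_linear_recursive[OF T0 t])
    fix \<rho>
    show "eventually (\<lambda>n. n mod T = \<rho> \<longrightarrow> puiseux_lt (f n) = t \<rho> n) sequentially"
      using ev[of \<rho>] by eventually_elim blast
  qed
  ultimately show ?thesis using piecewise_quadratic_quasi_polynomial[OF T0, of a b e] by blast
qed

end
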